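(* Let $n\ge1$ and let $\chi_q=(\chi_q^\gamma(T_{w_\beta}))_{\gamma,\beta\vdash n}$ be the character table of the Hecke algebra $H_n$ of $S_n$ (rows indexed by $\gamma$, columns by $\beta$). The condition of duality of the twisted Markov traces and the irreducible characters of $H_n$, i.e. the condition that, with $t=-r$, $$ (1-t)^{l(w_\beta)}\,\tau_q^\gamma(T_{w_\beta})= (1-q)^{l(w_\beta)}\,\chi_t^\gamma(T_{w_\beta})\qquad\text{for all }\gamma,\beta\vdash n, $$ is equivalent to the following relation for the character table: $$ M[\zeta_S(q)]\;\chi_q\; D[(1-q)^{l(\lambda)}]=\chi_q|_{q=0}, $$ where $D[(1-q)^{l(\lambda)}]$ is the diagonal matrix with diagonal entries $(1-q)^{l(\lambda)}$, $\lambda\vdash n$.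
   Context: Let $q,r$ be independent indeterminates and $t=-r$. Hecke algebra: $H_n$ is the Iwahori–Hecke algebra of $S_n$ with basis $T_w$ ($w\in S_n$), where $T_{s_i}^2=(q-1)T_{s_i}+q$ for $s_i=(i\; i+1)$ and $T_wT_{w'}=T_{ww'}$ if $l(ww')=l(w)+l(w')$, $l$ being the Coxeter length. Scalars are extended to $\mathbb{Q}(q,r)$. Its irreducible characters $\chi_q^\lambda$, $\lambda\vdash n$, are labelled so that $\chi_q^\lambda(T_w)|_{q=1}=\chi^\lambda(w)$, the usual irreducible character of $S_n$; in particular $\chi_q^{(n)}(T_w)=q^{l(w)}$ and $\chi_q^{(1^n)}(T_w)=(-1)^{l(w)}$. Put $\chi_t^\lambda(T_w)=\chi_q^\lambda(T_w)|_{q=t}$. For $\lambda=(\lambda_1,\dots,\lambda_{l(\lambda)})\vdash n$ with $l(\lambda)$ parts, $w_\lambda$ is the Coxeter element (the product of all simple reflections) of the Young subgroup $S_\lambda=S_{\lambda_1}\times\dots\times S_{\lambda_{l(\lambda)}}$, so $l(w_\lambda)=n-l(\lambda)$. Multiplication matrices: for a character $\zeta$ of $S_n$ (or a power series with such coefficients), $M[\zeta]$ is the matrix of tensor multiplication by $\zeta$ in the basis of irreducible characters, with entry $M[\zeta]^\gamma_\lambda$ in row $\gamma$ and column $\lambda$ given by $\zeta\otimes\chi^\gamma=\sum_{\lambda\vdash n}M[\zeta]^\gamma_\lambda\chi^\lambda$. Let $\zeta$ be the character of the $n$-dimensional permutation representation of $S_n$, let $\zeta_S^m,\zeta_A^m$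 be its $m$-th symmetric and exterior powers, and put $\zeta_S(q)=\sum_{j\ge0}\zeta_S^jq^j$, $\zeta_A(r)=\sum_{j\ge0}\zeta_A^jr^j$. Twisted Markov traces: for $\gamma\vdash n$, $$\tau_q^\gamma=\left(\frac{1-q}{1+r}\right)^n\sum_{\lambda\vdash n}M[\zeta_S(q)\otimes\zeta_A(r)]^\gamma_\lambda\,\chi_q^\lambda .$$ The same ordering of the partitions of $n$ is used for rows and columns of all matrices. *)

theory Defs
  imports
    "Jordan_Normal_Form.VS_Connect"
    "HOL-Combinatorics.Permutations"
    "HOL-Computational_Algebra.Computational_Algebra"
    "HOL-Library.Multiset"
    "HOL-Library.FuncSet"
begin

section \<open>Partitions, the symmetric group and its Young subgroups\<close>

definition partitions :: "nat \<Rightarrow> nat list set" where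
  "partitions n = {\<mu>. sorted_wrt (\<ge>) \<mu> \<and> 0 \<notin> set \<mu> \<and> sum_list \<mu> = n}"

definition conjugate_partition :: "nat list \<Rightarrow> nat list" where
  "conjugate_partition \<mu> =
     (if \<mu> = [] then [] else map (\<lambda>i. length (filter (\<lambda>a. i \<le> a) \<mu>)) [1..<Suc (hd \<mu>)])"

definition Sym :: "nat \<Rightarrow> (nat \<Rightarrow> nat) set" where
  "Sym n = {w. w permutes {1..n}}"

definition simple_refl :: "nat \<Rightarrow> nat \<Rightarrow> nat" where
  "simple_refl i = Transposition.transpose i (Suc i)"

definition refl_product :: "nat list \<Rightarrow> nat \<Rightarrow> nat" where
  "refl_product ks = foldr (\<circ>) (map simple_refl ks) id"

definition coxeter_length :: "nat \<Rightarrow> (nat \<Rightarrow> nat) \<Rightarrow> nat" where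
  "coxeter_length n w =
     (LEAST k. \<exists>ks. set ks \<subseteq> {1..<n} \<and> length ks = k \<and> w = refl_product ks)"

definition block :: "nat list \<Rightarrow> nat \<Rightarrow> nat set" where
  "block \<mu> j = {sum_list (take j \<mu>) <.. sum_list (take (Suc j) \<mu>)}"

definition young_subgroup :: "nat \<Rightarrow> nat list \<Rightarrow> (nat \<Rightarrow> nat) set" where
  "young_subgroup n \<mu> = {w \<in> Sym n. \<forall>j<length \<mu>. w ` block \<mu> j = block \<mu> j}"

text \<open>The simple reflections of the Young subgroup are multiplied in increasing order.\<close>

definition coxeter_element :: "nat \<Rightarrow> nat list \<Rightarrow> nat \<Rightarrow> nat" where
  "coxeter_element n \<mu> =
     refl_product (filter (\<lambda>i. simple_refl i \<in> young_subgroup n \<mu>) [1..<n])"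


section \<open>Matrix representations and irreducible characters\<close>

definition matrix_trace :: "'a::comm_monoid_add mat \<Rightarrow> 'a" where
  "matrix_trace A = (\<Sum>i<dim_row A. A $$ (i, i))"

text \<open>
  A family \<open>R\<close> of \<open>d \<times> d\<close> matrices, indexed by \<open>I\<close>, acts irreducibly on \<open>'a\<^sup>d\<close>.
  For the image of a basis of an algebra this is irreducibility of the representation.
\<close>

definition irreducible_family :: "'i set \<Rightarrow> nat \<Rightarrow> ('i \<Rightarrow> 'a::field mat) \<Rightarrow> bool" where
  "irreducible_family I d R \<longleftrightarrow> d > 0 \<and>
     (\<forall>W. VectorSpace.subspace class_ring W (module_vec TYPE('a) d) \<and> (\<forall>i\<in>I. \<forall>v\<in>W. R i *\<^sub>v v \<in> W)
        \<longrightarrow> W = {0\<^sub>v d} \<or> W = carrier_vec d)"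

definition symmetric_group_rep :: "nat \<Rightarrow> nat \<Rightarrow> ((nat \<Rightarrow> nat) \<Rightarrow> 'a::field mat) \<Rightarrow> bool" where
  "symmetric_group_rep n d R \<longleftrightarrow>
     (\<forall>w\<in>Sym n. R w \<in> carrier_mat d d) \<and> R id = 1\<^sub>m d \<and>
     (\<forall>u\<in>Sym n. \<forall>w\<in>Sym n. R (u \<circ> w) = R u * R w)"

text \<open>
  A representation of the Iwahori-Hecke algebra with parameter \<open>q\<close>, given by the images \<open>R w\<close>
  of the basis elements \<open>T\<^sub>w\<close>.  The relations below are the defining relations of the
  algebra, so extending \<open>R\<close> linearly to the span of the \<open>T\<^sub>w\<close> gives exactly the unital algebra
  homomorphisms into the \<open>d \<times> d\<close> matrices.
\<close>

definition hecke_rep :: "nat \<Rightarrow> 'a::field \<Rightarrow> nat \<Rightarrow> ((nat \<Rightarrow> nat) \<Rightarrow> 'a mat) \<Rightarrow> bool" where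
  "hecke_rep n q d R \<longleftrightarrow>
     (\<forall>w\<in>Sym n. R w \<in> carrier_mat d d) \<and> R id = 1\<^sub>m d \<and>
     (\<forall>i\<in>{1..<n}. R (simple_refl i) * R (simple_refl i) =
                    (q - 1) \<cdot>\<^sub>m R (simple_refl i) + q \<cdot>\<^sub>m 1\<^sub>m d) \<and>
     (\<forall>u\<in>Sym n. \<forall>w\<in>Sym n. coxeter_length n (u \<circ> w) = coxeter_length n u + coxeter_length n w
        \<longrightarrow> R (u \<circ> w) = R u * R w)"

text \<open>Characters are recorded by their values on group elements, resp. on the basis \<open>T\<^sub>w\<close>.\<close>

definition symmetric_group_irr :: "nat \<Rightarrow> ((nat \<Rightarrow> nat) \<Rightarrow> 'a::field) set" where
  "symmetric_group_irr n =
     {\<lambda>w\<in>Sym n. matrix_trace (R w) | d R.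
        symmetric_group_rep n d R \<and> irreducible_family (Sym n) d R}"

definition hecke_irr :: "nat \<Rightarrow> 'a::field \<Rightarrow> ((nat \<Rightarrow> nat) \<Rightarrow> 'a) set" where
  "hecke_irr n q =
     {\<lambda>w\<in>Sym n. matrix_trace (R w) | d R.
        hecke_rep n q d R \<and> irreducible_family (Sym n) d R}"

text \<open>
  The irreducible characters \<open>\<chi>\<^sup>\<lambda>\<close> of the symmetric group with their usual labels:
  \<open>\<chi>\<^sup>\<lambda>\<close> is the irreducible character that contains the trivial character when restricted to
  \<open>S\<^sub>\<lambda>\<close> and the sign character when restricted to \<open>S\<^sub>\<lambda>\<^sub>'\<close>, where \<open>\<lambda>'\<close> is the conjugate
  partition; thus \<open>(n)\<close> labels the trivial character.  All representations of the symmetric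
  group can be realized over the rationals.
\<close>

definition symmetric_group_characters ::
    "nat \<Rightarrow> (nat list \<Rightarrow> (nat \<Rightarrow> nat) \<Rightarrow> rat) \<Rightarrow> bool" where
  "symmetric_group_characters n chi \<longleftrightarrow>
     bij_betw (\<lambda>\<mu>. restrict (chi \<mu>) (Sym n)) (partitions n) (symmetric_group_irr n) \<and>
     (\<forall>\<mu>\<in>partitions n.
        (\<Sum>w\<in>young_subgroup n \<mu>. chi \<mu> w) \<noteq> 0 \<and>
        (\<Sum>w\<in>young_subgroup n (conjugate_partition \<mu>). of_int (sign w) * chi \<mu> w) \<noteq> 0)"

text \<open>
  The field \<open>\<rat>(q,r)\<close>, as the fraction field of \<open>\<rat>[q][r]\<close>, with its subring \<open>\<rat>[q]\<close>.
\<close>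

type_synonym ratfun = "rat poly poly fract"

definition ratfun_of_poly :: "rat poly \<Rightarrow> ratfun" where
  "ratfun_of_poly p = to_fract [:p:]"

definition ratfun_q :: ratfun where
  "ratfun_q = ratfun_of_poly [:0, 1:]"

text \<open>
  The irreducible characters of the Hecke algebra over \<open>\<rat>(q,r)\<close>, labelled through the
  specialization \<open>q = 1\<close>.  Their values on the \<open>T\<^sub>w\<close> are polynomials in \<open>q\<close>,
  which is what gives a meaning to all specializations; \<open>chi_q \<mu> w\<close> is this polynomial.
\<close>

definition hecke_characters ::
    "nat \<Rightarrow> (nat list \<Rightarrow> (nat \<Rightarrow> nat) \<Rightarrow> rat) \<Rightarrow> (nat list \<Rightarrow> (nat \<Rightarrow> nat) \<Rightarrow> rat poly) \<Rightarrow> bool"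
where
  "hecke_characters n chi chi_q \<longleftrightarrow>
     bij_betw (\<lambda>\<mu>. \<lambda>w\<in>Sym n. ratfun_of_poly (chi_q \<mu> w)) (partitions n) (hecke_irr n ratfun_q) \<and>
     (\<forall>\<mu>\<in>partitions n. \<forall>w\<in>Sym n. poly (chi_q \<mu> w) 1 = chi \<mu> w)"


section \<open>Power series in two variables\<close>

text \<open>
  \<open>\<zeta>\<^sub>S(q)\<close> and \<open>\<zeta>\<^sub>A(r)\<close> take values in the domain \<open>\<rat>[[q]][[r]]\<close>, which contains the
  polynomials in \<open>q\<close> and \<open>r\<close> and their quotients by powers of \<open>1 + r\<close>.
\<close>

type_synonym series = "rat fps fps"

definition series_q :: series where "series_q = fps_const fps_X"
definition series_r :: series where "series_r = fps_X"
definition series_t :: series where "series_t = - series_r"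

definition series_of_rat :: "rat \<Rightarrow> series" where
  "series_of_rat c = fps_const (fps_const c)"

definition poly_at :: "series \<Rightarrow> rat poly \<Rightarrow> series" where
  "poly_at x p = poly (map_poly series_of_rat p) x"


section \<open>Symmetric and exterior powers of the permutation representation\<close>

text \<open>
  In the symmetric power a permutation \<open>w\<close> permutes the basis of monomials
  \<open>e\<^sub>i\<^sub>1 \<cdots> e\<^sub>i\<^sub>m\<close>, indexed by multisets.
\<close>

definition zeta_S :: "nat \<Rightarrow> nat \<Rightarrow> (nat \<Rightarrow> nat) \<Rightarrow> rat" where
  "zeta_S n m w =
     of_nat (card {A. set_mset A \<subseteq> {1..n} \<and> size A = m \<and> image_mset w A = A})"

text \<open>
  In the exterior power \<open>w\<close> maps the basis element \<open>e\<^sub>A = e\<^sub>i\<^sub>1 \<and> \<cdots> \<and> e\<^sub>i\<^sub>m\<close> with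
  \<open>A = {i\<^sub>1 < \<cdots> < i\<^sub>m}\<close> to plus or minus the basis element of \<open>w ` A\<close>; if
  \<open>w ` A = A\<close>, the sign is the sign of the permutation \<open>w\<close> of \<open>A\<close>.
\<close>

definition zeta_A :: "nat \<Rightarrow> nat \<Rightarrow> (nat \<Rightarrow> nat) \<Rightarrow> rat" where
  "zeta_A n m w =
     (\<Sum>A | A \<subseteq> {1..n} \<and> card A = m \<and> w ` A = A. of_int (sign_on A w))"

definition zeta_S_series :: "nat \<Rightarrow> (nat \<Rightarrow> nat) \<Rightarrow> series" where
  "zeta_S_series n w = fps_const (Abs_fps (\<lambda>j. zeta_S n j w))"

definition zeta_A_series :: "nat \<Rightarrow> (nat \<Rightarrow> nat) \<Rightarrow> series" where
  "zeta_A_series n w = Abs_fps (\<lambda>j. fps_const (zeta_A n j w))"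

definition char_tensor :: "('g \<Rightarrow> series) \<Rightarrow> ('g \<Rightarrow> series) \<Rightarrow> 'g \<Rightarrow> series" where
  "char_tensor \<zeta> \<xi> w = \<zeta> w * \<xi> w"


section \<open>Matrices indexed by partitions, twisted Markov traces\<close>

type_synonym part_mat = "nat list \<Rightarrow> nat list \<Rightarrow> series"

definition part_mat_mult :: "nat \<Rightarrow> part_mat \<Rightarrow> part_mat \<Rightarrow> part_mat" where
  "part_mat_mult n A B \<gamma> \<beta> = (\<Sum>\<mu>\<in>partitions n. A \<gamma> \<mu> * B \<mu> \<beta>)"

definition part_mat_diag :: "(nat list \<Rightarrow> series) \<Rightarrow> part_mat" where
  "part_mat_diag f \<gamma> \<beta> = (if \<gamma> = \<beta> then f \<gamma> else 0)"

definition part_mat_eq :: "nat \<Rightarrow> part_mat \<Rightarrow> part_mat \<Rightarrow> bool" where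
  "part_mat_eq n A B \<longleftrightarrow> (\<forall>\<gamma>\<in>partitions n. \<forall>\<beta>\<in>partitions n. A \<gamma> \<beta> = B \<gamma> \<beta>)"

text \<open>
  Row \<open>\<gamma>\<close> of \<open>M[\<zeta>]\<close> consists of the coefficients in the expansion of \<open>\<zeta> \<otimes> \<chi>\<^sup>\<gamma>\<close> in the
  irreducible characters; for a class function \<open>\<zeta>\<close> they exist and are unique.
\<close>

definition mult_matrix ::
    "nat \<Rightarrow> (nat list \<Rightarrow> (nat \<Rightarrow> nat) \<Rightarrow> rat) \<Rightarrow> ((nat \<Rightarrow> nat) \<Rightarrow> series) \<Rightarrow> part_mat" where
  "mult_matrix n chi \<zeta> \<gamma> =
     (SOME c. \<forall>w\<in>Sym n. char_tensor \<zeta> (\<lambda>w. series_of_rat (chi \<gamma> w)) w =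
                        (\<Sum>\<mu>\<in>partitions n. c \<mu> * series_of_rat (chi \<mu> w)))"

text \<open>The table \<open>(\<chi>\<^sup>\<gamma>(T\<^sub>w\<^sub>\<beta>))\<close> of the Hecke algebra with \<open>q\<close> specialized to \<open>x\<close>.\<close>

definition character_table ::
    "nat \<Rightarrow> (nat list \<Rightarrow> (nat \<Rightarrow> nat) \<Rightarrow> rat poly) \<Rightarrow> series \<Rightarrow> part_mat" where
  "character_table n chi_q x \<gamma> \<beta> = poly_at x (chi_q \<gamma> (coxeter_element n \<beta>))"

definition markov_trace ::
    "nat \<Rightarrow> (nat list \<Rightarrow> (nat \<Rightarrow> nat) \<Rightarrow> rat) \<Rightarrow> (nat list \<Rightarrow> (nat \<Rightarrow> nat) \<Rightarrow> rat poly)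
       \<Rightarrow> nat list \<Rightarrow> (nat \<Rightarrow> nat) \<Rightarrow> series" where
  "markov_trace n chi chi_q \<gamma> w =
     ((1 - series_q) * inverse (1 + series_r)) ^ n *
     (\<Sum>\<mu>\<in>partitions n.
        mult_matrix n chi (char_tensor (zeta_S_series n) (zeta_A_series n)) \<gamma> \<mu> *
        poly_at series_q (chi_q \<mu> w))"

end

theory Submission
  imports Defs
begin

text \<open>
  Let \<open>X\<close> be the table of the characters of the symmetric group at the Coxeter elements \<open>w\<^sub>\<kappa>\<close> and
  \<open>X\<^sub>q\<close> that of the Hecke algebra. Tensor multiplication by \<open>\<zeta>\<close> is diagonal in values at group
  elements, so \<open>M[\<zeta>] = X diag(\<zeta>(w\<^sub>\<kappa>)) X\<^sup>-\<^sup>1\<close>. As \<open>\<zeta>\<^sub>S(q)(w)\<close> is the product of \<open>1/(1 - q\<^sup>c)\<close> over the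
  cycle lengths \<open>c\<close> of \<open>w\<close> and \<open>\<zeta>\<^sub>A(-q)(w)\<close> is its inverse, the duality says that
  \<open>M[\<zeta>\<^sub>S(q)] X\<^sub>q D[(1-q)\<^sup>l]\<close> does not change when \<open>q\<close> is replaced by \<open>t = -r\<close>. A power series with
  equal values at two independent indeterminates is constant, and its value at \<open>q = 0\<close> is \<open>X\<^sub>0\<close>.

  The matrix \<open>X\<close> is invertible without orthogonality relations: the span of the irreducible
  characters contains the characters of all rational representations, hence is closed under
  multiplication by the coefficients \<open>\<zeta>\<^sub>S\<^sup>m\<close>, and these separate the elements \<open>w\<^sub>\<kappa>\<close>.
\<close>


section \<open>Coxeter elements of Young subgroups\<close>

text \<open>The rows of \<open>mult_matrix\<close> are chosen by \<open>SOME\<close> and require an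
  expansion valid at every element of \<open>Sym n\<close>, while the hypotheses only say that
  \<open>chi\<close> enumerates the irreducible characters over the rationals. Existence of the
  expansion therefore rests on a fact about traces: a representation is split along invariant
  subspaces until irreducible ones remain, and the trace is the sum over the diagonal blocks.
  Uniqueness comes from evaluation at the Coxeter elements. Partitions index both the characters and
  these elements, so a one-sided inverse of \<open>X\<close> is two-sided. The exterior powers enter
  through their generating function alone: being inverse to the symmetric one, it expresses their
  characters as polynomials in the \<open>zeta_S n m\<close>. The exponents
  \<open>l(\<lambda>)\<close> originate in \<open>l(w_\<beta>) + l(\<beta>) = n\<close>: of the n
  factors (1-q)/(1-t) in the Markov trace, \<open>l(w_\<beta>)\<close> cancel against the powers in
  the duality, and \<open>l(\<beta>)\<close> remain.\<close>

lemma refl_product_Nil [simp]: "refl_product [] = id"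
  by (simp add: refl_product_def)

lemma refl_product_Cons [simp]: "refl_product (k # ks) = simple_refl k \<circ> refl_product ks"
  by (simp add: refl_product_def)

lemma refl_product_append: "refl_product (as @ bs) = refl_product as \<circ> refl_product bs"
  by (induction as) (simp_all add: o_assoc)

lemma refl_product_permutes:
  assumes "set ks \<subseteq> {1..<n}"
  shows "refl_product ks permutes {1..n}"
  using assms
proof (induction ks)
  case (Cons k ks)
  have "simple_refl k permutes {1..n}"
    using Cons.prems unfolding simple_refl_def by (intro permutes_swap_id) auto
  moreover have "refl_product ks permutes {1..n}" using Cons by simp
  ultimately show ?case unfolding refl_product_Cons by (intro permutes_compose)
qed (simp add: permutes_id)

lemma refl_product_fixes:
  assumes "\<And>k. k \<in> set ks \<Longrightarrow> x \<noteq> k \<and> x \<noteq> Suc k"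
  shows "refl_product ks x = x"
  using assms by (induction ks) (auto simp: simple_refl_def Transposition.transpose_def)

text \<open>Only \<open>simple_refl i\<close> moves a point across the cut between \<open>i\<close>
  and \<open>Suc i\<close>.\<close>

lemma refl_product_le_iff:
  assumes "i \<notin> set ks"
  shows "refl_product ks x \<le> i \<longleftrightarrow> x \<le> i"
  using assms by (induction ks) (auto simp: simple_refl_def Transposition.transpose_def)

text \<open>The rightmost factor acts first. Letters to the right of \<open>i\<close> are larger and
  fix \<open>i\<close>; letters to its left are smaller and fix \<open>Suc i\<close>.\<close>

lemma refl_product_increasing:
  assumes "sorted_wrt (<) ks" "i \<in> set ks"
  shows "refl_product ks i = Suc i"
proof -
  obtain as bs where ks: "ks = as @ i # bs" using assms(2) by (metis split_list)
  have "\<And>k. k \<in> set as \<Longrightarrow> k < i" "\<And>k. k \<in> set bs \<Longrightarrow> i < k"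
    using assms(1) by (auto simp: ks sorted_wrt_append)
  then have "refl_product bs i = i" "refl_product as (Suc i) = Suc i"
    by (fastforce intro!: refl_product_fixes)+
  then show ?thesis
    by (simp add: ks refl_product_append simple_refl_def)
qed

text \<open>
  A letter \<open>i\<close> cannot be missing from a word for \<open>w\<close> unless \<open>w\<close> preserves \<open>{1..i}\<close>.
\<close>

lemma coxeter_length_increasing:
  assumes "sorted_wrt (<) ks" "set ks \<subseteq> {1..<n}"
  shows "coxeter_length n (refl_product ks) = length ks"
  unfolding coxeter_length_def
proof (rule Least_equality)
  show "\<exists>ls. set ls \<subseteq> {1..<n} \<and> length ls = length ks \<and> refl_product ks = refl_product ls"
    using assms(2) by blast
next
  fix m
  assume "\<exists>ls. set ls \<subseteq> {1..<n} \<and> length ls = m \<and> refl_product ks = refl_product ls"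
  then obtain ls where ls: "length ls = m" "refl_product ks = refl_product ls" by blast
  have "set ks \<subseteq> set ls"
  proof
    fix i assume "i \<in> set ks"
    then have "refl_product ls i = Suc i"
      using refl_product_increasing[OF assms(1)] ls(2) by metis
    then show "i \<in> set ls" using refl_product_le_iff[of i ls i] by auto
  qed
  then have "card (set ks) \<le> card (set ls)" by (intro card_mono) auto
  also have "\<dots> \<le> m" using ls(1) card_length by blast
  finally show "length ks \<le> m"
    using assms(1) by (simp add: distinct_card strict_sorted_iff)
qed

section \<open>Block ends of a Young subgroup and the length of its Coxeter element\<close>

lemma partitionsD:
  assumes "\<mu> \<in> partitions n"
  shows "sorted_wrt (\<ge>) \<mu>" "\<And>a. a \<in> set \<mu> \<Longrightarrow> 0 < a" "sum_list \<mu> = n"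
  using assms by (auto simp: partitions_def intro: gr0I)

lemma sum_list_take_Suc:
  "j < length \<mu> \<Longrightarrow> sum_list (take (Suc j) \<mu>) = sum_list (take j \<mu>) + (\<mu> ! j :: nat)"
  by (simp add: take_Suc_conv_app_nth)

lemma sum_list_take_strict_mono:
  assumes "\<And>a. a \<in> set \<mu> \<Longrightarrow> 0 < (a::nat)"
  shows "strict_mono_on {..length \<mu>} (\<lambda>j. sum_list (take j \<mu>))"
proof (rule strict_mono_onI)
  fix i j assume "i \<in> {..length \<mu>}" "j \<in> {..length \<mu>}" "i < j"
  then have "Suc i \<le> j" "j \<le> length \<mu>" by auto
  then show "sum_list (take i \<mu>) < sum_list (take j \<mu>)"
  proof (induction j rule: dec_induct)
    case base
    then show ?case using assms[of "\<mu> ! i"] by (simp add: sum_list_take_Suc)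
  next
    case (step j)
    then show ?case by (simp add: sum_list_take_Suc)
  qed
qed

text \<open>\<open>i\<close> and \<open>Suc i\<close> lie in different blocks exactly when
  \<open>i\<close> is the right end of a block, and the right ends are the partial sums of the
  parts.\<close>

lemma simple_refl_in_young_subgroup_iff:
  assumes "\<mu> \<in> partitions n" "i \<in> {1..<n}"
  shows "simple_refl i \<in> young_subgroup n \<mu> \<longleftrightarrow>
         i \<notin> (\<lambda>j. sum_list (take j \<mu>)) ` {..length \<mu>}"
proof
  assume L: "simple_refl i \<in> young_subgroup n \<mu>"
  show "i \<notin> (\<lambda>j. sum_list (take j \<mu>)) ` {..length \<mu>}"
  proof
    assume "i \<in> (\<lambda>j. sum_list (take j \<mu>)) ` {..length \<mu>}"
    then obtain j where j: "j \<le> length \<mu>" "i = sum_list (take j \<mu>)" by auto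
    with assms(2) obtain k where k: "j = Suc k" by (cases j) auto
    have "0 < \<mu> ! k" using partitionsD(2)[OF assms(1)] j k by auto
    then have "i \<in> block \<mu> k"
      using j k by (auto simp: block_def sum_list_take_Suc)
    moreover have "simple_refl i ` block \<mu> k = block \<mu> k"
      using L j k by (auto simp: young_subgroup_def)
    ultimately have "simple_refl i i \<in> block \<mu> k" by blast
    then show False using j k by (simp add: simple_refl_def block_def)
  qed
next
  assume R: "i \<notin> (\<lambda>j. sum_list (take j \<mu>)) ` {..length \<mu>}"
  have "simple_refl i ` block \<mu> j = block \<mu> j" if "j < length \<mu>" for j
  proof -
    have "i \<noteq> sum_list (take j \<mu>)" "i \<noteq> sum_list (take (Suc j) \<mu>)"
      using R that by (auto simp del: take_Suc)
    then have "i \<in> block \<mu> j \<longleftrightarrow> Suc i \<in> block \<mu> j" by (auto simp: block_def)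
    then show ?thesis by (simp add: simple_refl_def)
  qed
  moreover have "simple_refl i \<in> Sym n"
    using assms(2) unfolding Sym_def simple_refl_def by (auto intro!: permutes_swap_id)
  ultimately show "simple_refl i \<in> young_subgroup n \<mu>" by (simp add: young_subgroup_def)
qed

definition young_generators :: "nat \<Rightarrow> nat list \<Rightarrow> nat list" where
  "young_generators n \<mu> = filter (\<lambda>i. simple_refl i \<in> young_subgroup n \<mu>) [1..<n]"

lemma coxeter_element_eq: "coxeter_element n \<mu> = refl_product (young_generators n \<mu>)"
  by (simp add: coxeter_element_def young_generators_def)

lemma young_generators_sorted: "sorted_wrt (<) (young_generators n \<mu>)"
  by (simp add: young_generators_def sorted_wrt_filter)

lemma young_generators_subset: "set (young_generators n \<mu>) \<subseteq> {1..<n}"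
  by (auto simp: young_generators_def)

lemma set_young_generators:
  assumes "\<mu> \<in> partitions n"
  shows "set (young_generators n \<mu>) = {1..<n} - (\<lambda>j. sum_list (take j \<mu>)) ` {..length \<mu>}"
  using simple_refl_in_young_subgroup_iff[OF assms] by (auto simp: young_generators_def)

lemma coxeter_element_permutes: "coxeter_element n \<mu> permutes {1..n}"
  unfolding coxeter_element_eq by (rule refl_product_permutes[OF young_generators_subset])

lemma coxeter_element_Sym: "coxeter_element n \<mu> \<in> Sym n"
  using coxeter_element_permutes by (simp add: Sym_def)

text \<open>From the n - 1 simple reflections those at the interior partial sums are removed;
  positive parts make these sums distinct, so there are \<open>length \<mu> - 1\<close> of them. The
  additive form avoids truncated subtraction.\<close>

lemma coxeter_length_coxeter_element:
  assumes "\<mu> \<in> partitions n"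
  shows "coxeter_length n (coxeter_element n \<mu>) + length \<mu> = n"
proof (cases "\<mu> = []")
  case True
  then have "n = 0" using partitionsD(3)[OF assms] by simp
  then show ?thesis using True coxeter_length_increasing[OF young_generators_sorted young_generators_subset, of n \<mu>]
    by (simp add: coxeter_element_eq young_generators_def)
next
  case False
  let ?p = "\<lambda>j. sum_list (take j \<mu>)"
  have mono: "strict_mono_on {..length \<mu>} ?p"
    using partitionsD(2)[OF assms] by (rule sum_list_take_strict_mono)
  have p: "?p 0 = 0" "?p (length \<mu>) = n" using partitionsD(3)[OF assms] by auto
  \<comment> \<open>The outer partial sums 0 and n lie outside \<open>{1..<n}\<close>, so only the
    interior ones remove a letter.\<close>
  have "{..length \<mu>} = insert 0 (insert (length \<mu>) {1..<length \<mu>})" using False by auto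
  then have "?p ` {..length \<mu>} = insert 0 (insert n (?p ` {1..<length \<mu>}))"
    using p by simp
  then have gens: "set (young_generators n \<mu>) = {1..<n} - ?p ` {1..<length \<mu>}"
    unfolding set_young_generators[OF assms] by auto
  have sub: "?p ` {1..<length \<mu>} \<subseteq> {1..<n}"
  proof
    fix x assume "x \<in> ?p ` {1..<length \<mu>}"
    then obtain j where j: "x = ?p j" "1 \<le> j" "j < length \<mu>" by auto
    have "?p 0 < ?p j" "?p j < ?p (length \<mu>)"
      using j strict_mono_onD[OF mono, of 0 j] strict_mono_onD[OF mono, of j "length \<mu>"] by simp_all
    then show "x \<in> {1..<n}" using p j by auto
  qed
  have inj: "inj_on ?p {1..<length \<mu>}"
    by (rule inj_on_subset[OF strict_mono_on_imp_inj_on[OF mono]]) auto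
  have "length (young_generators n \<mu>) = card (set (young_generators n \<mu>))"
    unfolding young_generators_def by (intro distinct_card[symmetric]) simp
  also have "\<dots> = (n - 1) - (length \<mu> - 1)"
    using card_Diff_subset[OF _ sub] gens card_image[OF inj] by simp
  finally have len: "length (young_generators n \<mu>) = (n - 1) - (length \<mu> - 1)" .
  have "card (?p ` {1..<length \<mu>}) \<le> card {1..<n}" using sub by (intro card_mono) auto
  then have "length \<mu> - 1 \<le> n - 1" using card_image[OF inj] by simp
  moreover have "n \<noteq> 0" using strict_mono_onD[OF mono, of 0 "length \<mu>"] p False by auto
  moreover have "length \<mu> \<noteq> 0" using False by simp
  ultimately show ?thesis
    using len coxeter_length_increasing[OF young_generators_sorted young_generators_subset, of n \<mu>]
    by (simp add: coxeter_element_eq)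
qed

lemma coxeter_element_le_iff:
  assumes "\<mu> \<in> partitions n" "j \<le> length \<mu>"
  shows "coxeter_element n \<mu> x \<le> sum_list (take j \<mu>) \<longleftrightarrow> x \<le> sum_list (take j \<mu>)"
  unfolding coxeter_element_eq
  by (rule refl_product_le_iff) (use assms in \<open>auto simp: set_young_generators\<close>)

lemma coxeter_element_in_block:
  assumes "\<mu> \<in> partitions n" "j < length \<mu>"
    and "sum_list (take j \<mu>) < i" "i < sum_list (take (Suc j) \<mu>)"
  shows "coxeter_element n \<mu> i = Suc i"
  unfolding coxeter_element_eq
proof (rule refl_product_increasing[OF young_generators_sorted])
  have mono: "strict_mono_on {..length \<mu>} (\<lambda>j. sum_list (take j \<mu>))"
    using partitionsD(2)[OF assms(1)] by (rule sum_list_take_strict_mono)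
  have "i \<noteq> sum_list (take k \<mu>)" if "k \<le> length \<mu>" for k
  proof (cases "k \<le> j")
    case True
    then have "sum_list (take k \<mu>) \<le> sum_list (take j \<mu>)"
      using strict_mono_on_leD[OF mono, of k j] assms(2) by simp
    then show ?thesis using assms(3) by simp
  next
    case False
    then have "sum_list (take (Suc j) \<mu>) \<le> sum_list (take k \<mu>)"
      using strict_mono_on_leD[OF mono, of "Suc j" k] that by simp
    then show ?thesis using assms(4) by simp
  qed
  moreover have "sum_list (take (Suc j) \<mu>) \<le> n"
    using strict_mono_on_leD[OF mono, of "Suc j" "length \<mu>"] assms(2) partitionsD(3)[OF assms(1)]
    by simp
  ultimately show "i \<in> set (young_generators n \<mu>)"
    unfolding set_young_generators[OF assms(1)] using assms(3,4) by auto
qed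


section \<open>Generating functions of symmetric and exterior powers\<close>

definition invariant_sets :: "'a set \<Rightarrow> ('a \<Rightarrow> 'a) \<Rightarrow> 'a set set" where
  "invariant_sets X w = {B. B \<subseteq> X \<and> w ` B = B}"

definition invariant_multisets :: "'a set \<Rightarrow> ('a \<Rightarrow> 'a) \<Rightarrow> nat \<Rightarrow> 'a multiset set" where
  "invariant_multisets X w m = {A. set_mset A \<subseteq> X \<and> size A = m \<and> image_mset w A = A}"

text \<open>The ground set is arbitrary so that the cycles of \<open>w\<close> can be split off one
  at a time.\<close>

definition sym_series :: "'a set \<Rightarrow> ('a \<Rightarrow> 'a) \<Rightarrow> rat fps" where
  "sym_series X w = Abs_fps (\<lambda>m. of_nat (card (invariant_multisets X w m)))"

text \<open>The expansion of det(1 - X w) in principal minors of a permutation matrix: a minor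
  vanishes unless its index set is invariant, and is then the sign of \<open>w\<close> on that set.
  The minus sign is built into the variable, which makes this the inverse of
  \<open>sym_series\<close>.\<close>

definition ext_series :: "'a set \<Rightarrow> ('a \<Rightarrow> 'a) \<Rightarrow> rat fps" where
  "ext_series X w = (\<Sum>B\<in>invariant_sets X w. of_int (sign_on B w) * (- fps_X) ^ card B)"

text \<open>The supports of the cycles of \<open>w\<close>, including fixed points.\<close>

definition is_cycle :: "('a \<Rightarrow> 'a) \<Rightarrow> 'a set \<Rightarrow> bool" where
  "is_cycle w C \<longleftrightarrow> finite C \<and> C \<noteq> {} \<and> w ` C = C \<and> (\<forall>B\<subseteq>C. w ` B = B \<longrightarrow> B = {} \<or> B = C)"

lemma ex_cycle:
  assumes "finite X" "X \<noteq> {}" "w ` X = X"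
  obtains C where "C \<subseteq> X" "is_cycle w C"
proof -
  let ?P = "\<lambda>C. C \<subseteq> X \<and> C \<noteq> {} \<and> w ` C = C"
  define C where "C = arg_min card ?P"
  have C: "?P C" "\<And>B. ?P B \<Longrightarrow> card C \<le> card B"
    unfolding C_def using arg_min_natI[of ?P X card] arg_min_nat_le[of ?P _ card] assms by blast+
  moreover have "finite C" using C(1) assms(1) finite_subset by blast
  ultimately have "is_cycle w C"
    unfolding is_cycle_def by (meson card_seteq subset_trans)
  with C(1) show thesis using that by blast
qed

lemma image_eq_self_if_subset:
  assumes "finite B" "inj w" "w ` B \<subseteq> B"
  shows "w ` B = B"
  using assms by (simp add: endo_inj_surj inj_on_subset)

text \<open>\<open>w\<close> preserves multiplicities in an invariant multiset, so a level set of
  \<open>count A\<close> inside \<open>C\<close> is invariant; by minimality of \<open>C\<close> it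
  is all of \<open>C\<close>.\<close>

lemma count_const_on_cycle:
  assumes "is_cycle w C" "inj w" "image_mset w A = A" "x \<in> C" "y \<in> C"
  shows "count A x = count A y"
proof -
  let ?B = "{z \<in> C. count A z = count A x}"
  have "count A (w z) = count A z" for z
  proof -
    have "w -` {w z} = {z}" using assms(2) by (auto simp: inj_def)
    then have "count (image_mset w A) (w z) = count A z"
      by (cases "z \<in># A") (auto simp: count_image_mset not_in_iff)
    then show ?thesis using assms(3) by simp
  qed
  then have "w ` ?B \<subseteq> ?B" using assms(1) by (auto simp: is_cycle_def)
  then have "w ` ?B = ?B"
    using assms(1,2) by (intro image_eq_self_if_subset) (auto simp: is_cycle_def)
  moreover have "x \<in> ?B" "?B \<subseteq> C" using assms(4) by auto
  ultimately have "?B = C" using assms(1) unfolding is_cycle_def by blast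
  then show ?thesis using assms(5) by (metis (mono_tags, lifting) mem_Collect_eq)
qed

lemma finite_invariant_multisets: "finite X \<Longrightarrow> finite (invariant_multisets X w m)"
proof -
  assume "finite X"
  then have "finite (multisets_of_size X m)" by (rule finite_multisets_of_size)
  then show ?thesis
    by (rule rev_finite_subset) (auto simp: invariant_multisets_def multisets_of_size_def)
qed

text \<open>An invariant multiset either avoids the cycle or contains all of it; in the second case
  one copy of \<open>C\<close> can be taken away. This is the coefficient form of S(X) = S(X - C) +
  x^c S(X), where c is the size of \<open>C\<close>.\<close>

lemma card_invariant_multisets_remove_cycle:
  assumes "finite X" "inj w" "C \<subseteq> X" "is_cycle w C"
  shows "card (invariant_multisets X w m) = card (invariant_multisets (X - C) w m) +
           (if card C \<le> m then card (invariant_multisets X w (m - card C)) else 0)"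
proof -
  let ?I = "\<lambda>m. invariant_multisets X w m" and ?f = "\<lambda>A. A + mset_set C"
  have C: "finite C" "w ` C = C" "C \<noteq> {}" using assms(4) by (auto simp: is_cycle_def)
  have inv_C: "image_mset w (mset_set C) = mset_set C"
    using C inj_on_subset[OF assms(2)] by (simp add: image_mset_mset_set)
  have split: "?I m = invariant_multisets (X - C) w m \<union> {A \<in> ?I m. C \<subseteq> set_mset A}"
  proof (intro equalityI subsetI)
    fix A assume A: "A \<in> ?I m"
    show "A \<in> invariant_multisets (X - C) w m \<union> {A \<in> ?I m. C \<subseteq> set_mset A}"
    proof (cases "set_mset A \<inter> C = {}")
      case True
      then show ?thesis using A by (auto simp: invariant_multisets_def)
    next
      case False
      then obtain x where x: "x \<in># A" "x \<in> C" by auto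
      have "y \<in># A" if "y \<in> C" for y
      proof -
        have "count A x = count A y"
          using A x that by (intro count_const_on_cycle[OF assms(4,2)]) (auto simp: invariant_multisets_def)
        then show ?thesis using x by (metis count_greater_zero_iff)
      qed
      then show ?thesis using A by auto
    qed
  qed (auto simp: invariant_multisets_def)
  have disj: "invariant_multisets (X - C) w m \<inter> {A \<in> ?I m. C \<subseteq> set_mset A} = {}"
    using C(3) by (auto simp: invariant_multisets_def)
  have "card (?I m) = card (invariant_multisets (X - C) w m) + card {A \<in> ?I m. C \<subseteq> set_mset A}"
    by (subst split, rule card_Un_disjoint)
      (use disj assms(1) finite_invariant_multisets[of X w m] finite_invariant_multisets[of "X - C" w m] in auto)
  moreover have "card {A \<in> ?I m. C \<subseteq> set_mset A} = (if card C \<le> m then card (?I (m - card C)) else 0)"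
  proof (cases "card C \<le> m")
    case True
    have "{A \<in> ?I m. C \<subseteq> set_mset A} = ?f ` ?I (m - card C)"
    proof (intro equalityI subsetI)
      fix A assume "A \<in> {A \<in> ?I m. C \<subseteq> set_mset A}"
      then have A: "set_mset A \<subseteq> X" "size A = m" "image_mset w A = A" "C \<subseteq> set_mset A"
        by (auto simp: invariant_multisets_def)
      have le: "mset_set C \<subseteq># A"
        using subset_imp_msubset_mset_set[OF A(4)] mset_set_set_mset_msubset subset_mset.trans by blast
      then have "A = ?f (A - mset_set C)" by simp
      moreover have "A - mset_set C \<in> ?I (m - card C)"
        using A le inv_C
        by (auto simp: invariant_multisets_def size_Diff_submset image_mset_Diff dest: in_diffD)
      ultimately show "A \<in> ?f ` ?I (m - card C)" by blast
    next
      fix A assume "A \<in> ?f ` ?I (m - card C)"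
      then show "A \<in> {A \<in> ?I m. C \<subseteq> set_mset A}"
        using True assms(3) C(1) inv_C by (auto simp: invariant_multisets_def)
    qed
    moreover have "inj_on ?f (?I (m - card C))" by (simp add: inj_on_def)
    ultimately show ?thesis using True by (simp add: card_image)
  next
    case False
    have "\<not> C \<subseteq> set_mset A" if "A \<in> ?I m" for A
    proof
      assume "C \<subseteq> set_mset A"
      then have "card C \<le> card (set_mset A)" by (intro card_mono) auto
      also have "\<dots> \<le> size A"
        using size_mset_mono[OF mset_set_set_mset_msubset[of A]] by simp
      finally show False using False that by (simp add: invariant_multisets_def)
    qed
    then have empty: "{A \<in> ?I m. C \<subseteq> set_mset A} = {}" by blast
    show ?thesis unfolding empty using False by simp
  qed
  ultimately show ?thesis by simp
qed

lemma sym_series_remove_cycle: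
  assumes "finite X" "inj w" "C \<subseteq> X" "is_cycle w C"
  shows "(1 - fps_X ^ card C) * sym_series X w = sym_series (X - C) w"
proof (rule fps_ext)
  fix m
  have "fps_nth ((1 - fps_X ^ card C) * sym_series X w) m =
        fps_nth (sym_series X w) m - fps_nth (fps_X ^ card C * sym_series X w) m"
    by (simp add: algebra_simps)
  also have "\<dots> = fps_nth (sym_series (X - C) w) m"
    using card_invariant_multisets_remove_cycle[OF assms, of m]
    by (simp add: sym_series_def fps_X_power_mult_nth not_le)
  finally show "fps_nth ((1 - fps_X ^ card C) * sym_series X w) m = fps_nth (sym_series (X - C) w) m" .
qed

section \<open>Signs of cycles and the exterior generating function\<close>

lemma sign_on_Un:
  assumes "finite A" "finite B" "A \<inter> B = {}" "w ` A = A" "w ` B = B" "inj w"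
  shows "sign_on (A \<union> B) w = sign_on A w * sign_on B w"
proof -
  have bij: "bij_betw w A A" "bij_betw w B B"
    using assms inj_on_subset[OF assms(6)] by (auto simp: bij_betw_def)
  have "restrict_id w (A \<union> B) = restrict_id w A \<circ> restrict_id w B"
  proof
    fix x
    show "restrict_id w (A \<union> B) x = (restrict_id w A \<circ> restrict_id w B) x"
    proof (cases "x \<in> B")
      case True
      then have "w x \<in> B" using assms(5) by (metis imageI)
      then have "x \<notin> A" "w x \<notin> A" using True assms(3) by auto
      then show ?thesis using True by (simp add: restrict_id_def)
    next
      case False
      then show ?thesis by (simp add: restrict_id_def)
    qed
  qed
  moreover have "permutation (restrict_id w A)" "permutation (restrict_id w B)"
    using permutes_imp_permutation[OF assms(1) permutes_restrict_id[OF bij(1)]]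
      permutes_imp_permutation[OF assms(2) permutes_restrict_id[OF bij(2)]] by blast+
  ultimately show ?thesis by (simp add: sign_on_def sign_compose)
qed

lemma sign_on_singleton: "w x = x \<Longrightarrow> sign_on {x} w = 1"
  using sign_on_cong[of "{x}" "{x}" w id] by simp

text \<open>Composing \<open>w\<close> with the transposition of \<open>x\<close> and
  \<open>w x\<close> fixes \<open>x\<close> and leaves a cycle on \<open>C - {x}\<close>, at the
  price of one sign.\<close>

lemma sign_on_cycle:
  assumes "is_cycle w C" "inj w"
  shows "sign_on C w = (- 1) ^ (card C - 1)"
  using assms
proof (induction "card C" arbitrary: C w)
  case 0
  then show ?case by (auto simp: is_cycle_def)
next
  case (Suc k)
  have C: "finite C" "w ` C = C" "C \<noteq> {}" "\<And>B. B \<subseteq> C \<Longrightarrow> w ` B = B \<Longrightarrow> B = {} \<or> B = C"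
    using Suc.prems(1) by (auto simp: is_cycle_def)
  then obtain x where x: "x \<in> C" by auto
  define y where "y = w x"
  have y: "y \<in> C" using x C(2) y_def by blast
  show ?case
  proof (cases "y = x")
    case True
    then have "C = {x}" using C(4)[of "{x}"] x y_def by auto
    then show ?thesis using True by (simp add: sign_on_singleton y_def)
  next
    case False
    define v where "v = Transposition.transpose x y \<circ> w"
    have inj_v: "inj v" unfolding v_def using Suc.prems(2) by (intro inj_compose) auto
    have vx: "v x = x" by (simp add: v_def y_def)
    have v_image: "v ` B = w ` B" if "x \<in> w ` B \<longleftrightarrow> y \<in> w ` B" for B
    proof -
      have "v ` B = Transposition.transpose x y ` w ` B" by (simp add: v_def image_comp)
      then show ?thesis using that by simp
    qed
    have vC: "v ` C = C" using v_image[of C] C(2) x y by simp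
    have vD: "v ` (C - {x}) = C - {x}"
      using image_set_diff[OF inj_v, of C "{x}"] vC vx by simp
    have cyc: "is_cycle v (C - {x})"
      unfolding is_cycle_def
    proof (intro conjI allI impI)
      show "finite (C - {x})" "C - {x} \<noteq> {}" using C(1) False y by auto
      show "v ` (C - {x}) = C - {x}" by (rule vD)
      fix B assume B: "B \<subseteq> C - {x}" "v ` B = B"
      show "B = {} \<or> B = C - {x}"
      \<comment> \<open>The transposition preserves a set that contains both or neither of
        \<open>x\<close> and \<open>y\<close>. So if \<open>y\<close> is in \<open>B\<close>, the
        \<open>v\<close>-fixed point \<open>x\<close> is added; otherwise \<open>B\<close> already
        avoids both. Either set is then \<open>w\<close>-invariant, and minimality of
        \<open>C\<close> applies.\<close>
      proof (cases "y \<in> B")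
        case True
        have "v ` insert x B = insert x B" using B(2) vx by simp
        moreover have "w ` insert x B = Transposition.transpose x y ` v ` insert x B"
          by (simp only: v_def image_comp o_assoc) simp
        ultimately have "w ` insert x B = Transposition.transpose x y ` insert x B"
          by (simp only:)
        also have "\<dots> = insert x B" using True by (intro transpose_image_eq) simp
        finally have "w ` insert x B = insert x B" .
        then have "insert x B = C" using C(4)[of "insert x B"] B(1) x by blast
        then show ?thesis using B(1) by auto
      next
        case False
        have "w ` B = Transposition.transpose x y ` v ` B"
          by (simp add: v_def image_comp o_assoc)
        also have "\<dots> = B"
          using False B by (subst B(2), intro transpose_image_eq) auto
        finally have "w ` B = B" .
        then show ?thesis using C(4)[of B] B(1) x by blast
      qed
    qed
    have card: "card (C - {x}) = k"
      using Suc.hyps(2) card_Diff_singleton[OF x] by linarith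
    have "sign_on (C - {x}) v = (- 1) ^ (k - 1)"
      using Suc.hyps(1)[OF card[symmetric] cyc inj_v] unfolding card .
    moreover have "sign_on ((C - {x}) \<union> {x}) v = sign_on (C - {x}) v * sign_on {x} v"
      by (rule sign_on_Un[OF _ _ _ vD _ inj_v]) (use C(1) vx in simp_all)
    moreover have "(C - {x}) \<union> {x} = C" using x by auto
    ultimately have v_sign: "sign_on C v = (- 1) ^ (k - 1)"
      by (simp only: sign_on_singleton[of v x, OF vx] mult_1_right)
    have bij: "bij_betw w C C" "bij_betw (Transposition.transpose x y) C C"
      using C(2) inj_on_subset[OF Suc.prems(2)] x y by (simp_all add: bij_betw_def)
    have "sign_on C v = sign_on C (Transposition.transpose x y) * sign_on C w"
      unfolding v_def using bij C(1) by (intro sign_on_compose)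
    moreover have "sign_on C (Transposition.transpose x y) = - 1"
      using False x y by (intro sign_on_transpose) auto
    ultimately have w_sign: "sign_on C w = - ((- 1) ^ (k - 1))" using v_sign by simp
    have "k \<noteq> 0"
      unfolding card[symmetric] using cyc by (simp add: is_cycle_def)
    then obtain j where j: "k = Suc j" by (cases k) auto
    have card_C: "card C - 1 = Suc j" unfolding Suc.hyps(2)[symmetric] j by simp
    show ?thesis unfolding w_sign card_C j by simp
  qed
qed

lemma finite_invariant_sets: "finite X \<Longrightarrow> finite (invariant_sets X w)"
  by (rule finite_subset[of _ "Pow X"]) (auto simp: invariant_sets_def)

text \<open>An invariant set avoids or contains the cycle. With c the size of \<open>C\<close>,
  adjoining \<open>C\<close> multiplies a term by (-1)^(c-1) (-X)^c = -X^c, whence the factor 1 -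
  X^c.\<close>

lemma ext_series_remove_cycle:
  assumes "finite X" "inj w" "C \<subseteq> X" "is_cycle w C"
  shows "ext_series X w = (1 - fps_X ^ card C) * ext_series (X - C) w"
proof -
  have C: "finite C" "w ` C = C" "C \<noteq> {}" "\<And>B. B \<subseteq> C \<Longrightarrow> w ` B = B \<Longrightarrow> B = {} \<or> B = C"
    using assms(4) by (auto simp: is_cycle_def)
  let ?J = "invariant_sets (X - C) w" and ?f = "\<lambda>B. B \<union> C"
  let ?t = "\<lambda>B. of_int (sign_on B w) * (- fps_X) ^ card B :: rat fps"
  have split: "invariant_sets X w = ?J \<union> ?f ` ?J"
  proof (intro equalityI subsetI)
    fix B assume "B \<in> invariant_sets X w"
    then have B: "B \<subseteq> X" "w ` B = B" by (auto simp: invariant_sets_def)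
    have "w ` (B \<inter> C) = B \<inter> C" using B C(2) by (simp add: image_Int[OF assms(2)])
    then consider "B \<inter> C = {}" | "B \<inter> C = C" using C(4)[of "B \<inter> C"] by auto
    then show "B \<in> ?J \<union> ?f ` ?J"
    proof cases
      case 1
      then show ?thesis using B unfolding invariant_sets_def by blast
    next
      case 2
      have "w ` (B - C) = B - C" using B C(2) by (simp add: image_set_diff[OF assms(2)])
      then have "B - C \<in> ?J" using B(1) unfolding invariant_sets_def by blast
      moreover have "B = ?f (B - C)" using 2 Un_Diff_cancel2[of B C] by (simp only: Int_absorb2 Un_absorb2 le_iff_inf inf_commute)
      ultimately show ?thesis by blast
    qed
  next
    fix B assume "B \<in> ?J \<union> ?f ` ?J"
    then obtain B' where "B' \<in> ?J" "B = B' \<or> B = B' \<union> C" by blast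
    then have "B' \<subseteq> X" "w ` B' = B'" "B = B' \<or> B = B' \<union> C"
      unfolding invariant_sets_def by blast+
    then show "B \<in> invariant_sets X w"
      using assms(3) C(2) unfolding invariant_sets_def by (auto simp only: mem_Collect_eq image_Un Un_subset_iff)
  qed
  have "B \<inter> C = {}" if "B \<in> ?J" for B using that unfolding invariant_sets_def by blast
  then have disj: "?J \<inter> ?f ` ?J = {}" using C(3) by blast
  have "?f B - C = B" if "B \<in> ?J" for B using that unfolding invariant_sets_def by blast
  then have inj: "inj_on ?f ?J" by (rule inj_on_inverseI)
  have "(- 1) ^ (card C - 1) * (- fps_X) ^ card C = - (fps_X ^ card C :: rat fps)"
  proof -
    obtain k where k: "card C = Suc k" using C(1,3) by (cases "card C") auto
    have "(- 1) ^ k * (- fps_X) ^ k = (fps_X ^ k :: rat fps)" by (simp flip: power_mult_distrib)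
    then show ?thesis unfolding k by (simp add: mult_ac)
  qed
  then have sgn: "of_int (sign_on C w) * (- fps_X) ^ card C = - (fps_X ^ card C :: rat fps)"
    by (simp add: sign_on_cycle[OF assms(4,2)])
  have shift: "?t (?f B) = - (fps_X ^ card C) * ?t B" if "B \<in> ?J" for B
  proof -
    have "B \<subseteq> X - C" "w ` B = B" using that unfolding invariant_sets_def by blast+
    then have B: "B \<inter> C = {}" "w ` B = B" "finite B"
      using assms(1) finite_subset[of B X] by blast+
    have "?t (?f B) = ?t B * (of_int (sign_on C w) * (- fps_X) ^ card C)"
      using B C(1,2) assms(2) by (simp add: sign_on_Un card_Un_disjoint power_add mult_ac)
    then show ?thesis unfolding sgn by simp
  qed
  have "ext_series X w = (\<Sum>B\<in>?J. ?t B) + (\<Sum>B\<in>?f ` ?J. ?t B)"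
    unfolding ext_series_def split
    using assms(1) disj by (intro sum.union_disjoint) (auto intro: finite_invariant_sets)
  also have "(\<Sum>B\<in>?f ` ?J. ?t B) = (\<Sum>B\<in>?J. - (fps_X ^ card C) * ?t B)"
    using shift by (simp add: sum.reindex[OF inj])
  also have "\<dots> = - (fps_X ^ card C) * (\<Sum>B\<in>?J. ?t B)" by (rule sum_distrib_left [symmetric])
  finally show ?thesis by (simp add: ext_series_def algebra_simps)
qed

lemma sym_series_empty: "sym_series {} w = 1"
proof -
  have "invariant_multisets {} w m = (if m = 0 then {{#}} else {})" for m
    by (auto simp: invariant_multisets_def)
  then show ?thesis by (auto simp: sym_series_def fps_eq_iff)
qed

lemma ext_series_empty: "ext_series {} w = 1"
proof -
  have "invariant_sets {} w = {{}}" by (auto simp: invariant_sets_def)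
  moreover have "sign_on {} w = 1" using sign_on_cong[of "{}" "{}" w id] by simp
  ultimately show ?thesis by (simp add: ext_series_def)
qed

text \<open>Removing a cycle of length c multiplies \<open>sym_series\<close> by 1 - X^c and removes
  that same factor from \<open>ext_series\<close>, so the product stays the same down to the empty
  set.\<close>

lemma sym_series_mult_ext_series:
  assumes "finite X" "inj w" "w ` X = X"
  shows "sym_series X w * ext_series X w = 1"
  using assms
proof (induction "card X" arbitrary: X rule: less_induct)
  case less
  show ?case
  proof (cases "X = {}")
    case True
    then show ?thesis by (simp add: sym_series_empty ext_series_empty)
  next
    case False
    then obtain C where C: "C \<subseteq> X" "is_cycle w C" using ex_cycle less.prems by metis
    have "card (X - C) < card X"
      using C less.prems(1) by (intro psubset_card_mono) (auto simp: is_cycle_def)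
    moreover have "w ` (X - C) = X - C"
      using C less.prems by (simp add: image_set_diff is_cycle_def)
    ultimately have "sym_series (X - C) w * ext_series (X - C) w = 1"
      using less by simp
    moreover have "sym_series X w * ext_series X w =
        ((1 - fps_X ^ card C) * sym_series X w) * ext_series (X - C) w"
      unfolding ext_series_remove_cycle[OF less.prems(1,2) C] by (simp only: mult_ac)
    ultimately show ?thesis unfolding sym_series_remove_cycle[OF less.prems(1,2) C] by simp
  qed
qed

lemma fps_nth_ext_series:
  assumes "finite X"
  shows "fps_nth (ext_series X w) m =
    (- 1) ^ m * (\<Sum>B | B \<subseteq> X \<and> card B = m \<and> w ` B = B. of_int (sign_on B w))"
proof -
  have "fps_nth (of_int c * (- fps_X) ^ k :: rat fps) m = (if k = m then (- 1) ^ m * of_int c else 0)" for c k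
  proof -
    have "(- 1 :: rat fps) ^ k = fps_const ((- 1) ^ k)"
      by (metis fps_const_1_eq_1 fps_const_neg fps_const_power)
    then have "(- fps_X) ^ k = fps_const ((- 1) ^ k) * (fps_X ^ k :: rat fps)"
      by (metis power_minus)
    then have "of_int c * (- fps_X) ^ k = fps_const (of_int c) * (fps_const ((- 1) ^ k) * (fps_X ^ k :: rat fps))"
      by (simp only: fps_of_int)
    then show ?thesis by (simp add: fps_X_power_iff)
  qed
  then have "fps_nth (ext_series X w) m =
      (\<Sum>B\<in>invariant_sets X w. if card B = m then (- 1) ^ m * of_int (sign_on B w) else 0)"
    by (simp add: ext_series_def fps_sum_nth)
  also have "\<dots> = (\<Sum>B | B \<in> invariant_sets X w \<and> card B = m. (- 1) ^ m * of_int (sign_on B w))"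
    by (rule sum.inter_filter [symmetric, OF finite_invariant_sets[OF assms]])
  also have "\<dots> = (- 1) ^ m * (\<Sum>B | B \<subseteq> X \<and> card B = m \<and> w ` B = B. of_int (sign_on B w))"
  proof -
    have "{B. B \<in> invariant_sets X w \<and> card B = m} = {B. B \<subseteq> X \<and> card B = m \<and> w ` B = B}"
      unfolding invariant_sets_def mem_Collect_eq by (simp only: conj_ac)
    then show ?thesis unfolding sum_distrib_left by (simp only:)
  qed
  finally show ?thesis .
qed

lemma zeta_S_eq: "zeta_S n m w = fps_nth (sym_series {1..n} w) m"
  unfolding zeta_S_def sym_series_def invariant_multisets_def by (simp only: fps_nth_Abs_fps)

lemma zeta_A_eq: "zeta_A n m w = (- 1) ^ m * fps_nth (ext_series {1..n} w) m"
proof -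
  have "(- 1) ^ m * ((- 1) ^ m * x) = x" for x :: rat by (cases "even m") auto
  then show ?thesis unfolding zeta_A_def fps_nth_ext_series[OF finite_atLeastAtMost] by (rule sym)
qed


text \<open>Below the right end of the block the Coxeter element maps each point to its successor,
  so every nonempty invariant subset of the block contains the right end. A proper nonempty one and
  its complement in the block would both contain it.\<close>

lemma is_cycle_block:
  assumes "\<mu> \<in> partitions n" "j < length \<mu>"
  shows "is_cycle (coxeter_element n \<mu>) (block \<mu> j)"
proof -
  let ?w = "coxeter_element n \<mu>" and ?a = "sum_list (take j \<mu>)" and ?b = "sum_list (take (Suc j) \<mu>)"
  have inj: "inj ?w" using coxeter_element_permutes permutes_inj by blast
  have "?a < ?b"
    using assms partitionsD(2)[OF assms(1), of "\<mu> ! j"] by (simp add: sum_list_take_Suc)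
  moreover have block: "block \<mu> j = {?a<..?b}" by (simp add: block_def)
  moreover have "?w x \<in> {?a<..?b} \<longleftrightarrow> x \<in> {?a<..?b}" for x
  proof -
    have "?w x \<le> ?a \<longleftrightarrow> x \<le> ?a" "?w x \<le> ?b \<longleftrightarrow> x \<le> ?b"
      using assms by (simp_all add: coxeter_element_le_iff del: take_Suc)
    then show ?thesis unfolding greaterThanAtMost_iff by (meson not_le)
  qed
  then have "?w ` {?a<..?b} \<subseteq> {?a<..?b}" by blast
  then have image: "?w ` {?a<..?b} = {?a<..?b}"
    by (intro image_eq_self_if_subset inj finite_greaterThanAtMost)
  have top: "?b \<in> B" if B: "B \<subseteq> {?a<..?b}" "?w ` B = B" "x \<in> B" for B x
  proof -
    have "y \<le> ?b \<longrightarrow> y \<in> B" if "x \<le> y" for y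
      using that
    proof (induction y rule: dec_induct)
      case base
      then show ?case using B(3) by simp
    next
      case (step y)
      show ?case
      proof
        assume "Suc y \<le> ?b"
        then have y: "y \<in> B" "y < ?b" using step.IH by auto
        then have "?a < y" using B(1) by auto
        then have "?w y = Suc y" using y(2) by (intro coxeter_element_in_block[OF assms])
        then show "Suc y \<in> B" using B(2) y(1) by (metis imageI)
      qed
    qed
    moreover have "x \<le> ?b" using B by auto
    ultimately show ?thesis by simp
  qed
  have "B = {} \<or> B = {?a<..?b}" if B: "B \<subseteq> {?a<..?b}" "?w ` B = B" for B
  proof (rule ccontr)
    assume neg: "\<not> (B = {} \<or> B = {?a<..?b})"
    then obtain x y where xy: "x \<in> B" "y \<in> {?a<..?b} - B" using B(1) by blast
    have "?w ` ({?a<..?b} - B) = {?a<..?b} - B"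
      using image_set_diff[OF inj, of "{?a<..?b}" B] image B(2) by simp
    then have "?b \<in> {?a<..?b} - B" using xy(2) by (intro top[of _ y]) auto
    moreover have "?b \<in> B" using top[OF B xy(1)] .
    ultimately show False by simp
  qed
  ultimately show ?thesis using image unfolding is_cycle_def by simp
qed

lemma sym_series_coxeter_element:
  assumes "\<mu> \<in> partitions n"
  shows "sym_series {1..n} (coxeter_element n \<mu>) * (\<Prod>a\<in>#mset \<mu>. 1 - fps_X ^ a) = 1"
proof -
  let ?w = "coxeter_element n \<mu>" and ?p = "\<lambda>j. sum_list (take j \<mu>)"
  \<comment> \<open>The blocks are consecutive intervals, so the first \<open>j\<close> of them fill
    \<open>{1..?p j}\<close>; passing from \<open>Suc j\<close> to \<open>j\<close> removes exactly
    one cycle.\<close>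
  have "sym_series {1..?p j} ?w * (\<Prod>a\<in>#mset (take j \<mu>). 1 - fps_X ^ a) = 1"
    if "j \<le> length \<mu>" for j
    using that
  proof (induction j)
    case 0
    then show ?case by (simp add: sym_series_empty)
  next
    case (Suc j)
    have j: "j < length \<mu>" using Suc.prems by simp
    have p: "?p (Suc j) = ?p j + \<mu> ! j" using j by (rule sum_list_take_Suc)
    have block: "block \<mu> j = {?p j<..?p j + \<mu> ! j}" unfolding block_def p ..
    have "(1 - fps_X ^ card (block \<mu> j)) * sym_series {1..?p (Suc j)} ?w =
          sym_series ({1..?p (Suc j)} - block \<mu> j) ?w"
      using coxeter_element_permutes permutes_inj is_cycle_block[OF assms j]
      by (intro sym_series_remove_cycle) (auto simp: p block)
    moreover have "{1..?p (Suc j)} - block \<mu> j = {1..?p j}" by (auto simp: p block)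
    moreover have "card (block \<mu> j) = \<mu> ! j" by (simp add: block)
    ultimately have "sym_series {1..?p j} ?w = (1 - fps_X ^ (\<mu> ! j)) * sym_series {1..?p (Suc j)} ?w"
      by simp
    moreover have "mset (take (Suc j) \<mu>) = add_mset (\<mu> ! j) (mset (take j \<mu>))"
      using j by (simp add: take_Suc_conv_app_nth)
    ultimately show ?case using Suc.IH j by (simp add: mult_ac del: take_Suc)
  qed
  from this[of "length \<mu>"] show ?thesis using partitionsD(3)[OF assms] by simp
qed

text \<open>When all exponents are at least \<open>b\<close>, the product is 1 - m X^b modulo
  X^(b+1), where m is the multiplicity of \<open>b\<close>.\<close>

lemma fps_nth_euler_product:
  assumes "\<And>a. a \<in># M \<Longrightarrow> b \<le> a" "0 < b" "j \<le> b"
  shows "fps_nth (\<Prod>a\<in>#M. 1 - fps_X ^ a :: rat fps) j =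
         (if j = 0 then 1 else if j < b then 0 else - of_nat (count M b))"
  using assms(1,3)
proof (induction M arbitrary: j)
  case empty
  then show ?case by simp
next
  case (add a M)
  have a: "b \<le> a" using add.prems by simp
  let ?F = "\<Prod>a\<in>#M. 1 - fps_X ^ a :: rat fps"
  have IH: "fps_nth ?F j = (if j = 0 then 1 else if j < b then 0 else - of_nat (count M b))" if "j \<le> b" for j
    using add that by simp
  have "fps_nth (\<Prod>a\<in>#add_mset a M. 1 - fps_X ^ a :: rat fps) j =
        fps_nth ?F j - (if j < a then 0 else fps_nth ?F (j - a))"
    by (simp add: left_diff_distrib fps_X_power_mult_nth)
  \<comment> \<open>As \<open>j \<le> b \<le> a\<close>, the shifted term occurs only for
    \<open>j = a = b\<close>, where it is the constant coefficient 1.\<close>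
  then show ?case
    using IH[of j] IH[of "j - a"] add.prems(2) a assms(2) by auto
qed

text \<open>Multiplicities are read off in increasing order. The factors with exponent below
  \<open>b\<close> agree by induction and cancel, their product having constant term 1; the
  coefficient of X^b in what remains is minus the multiplicity of \<open>b\<close>. An exponent 0
  would make the product vanish.\<close>

lemma euler_product_inject:
  assumes "(\<Prod>a\<in>#M. 1 - fps_X ^ a :: rat fps) = (\<Prod>a\<in>#N. 1 - fps_X ^ a)"
    and "0 \<notin># M" "0 \<notin># N"
  shows "M = N"
proof (rule multiset_eqI)
  let ?P = "\<lambda>M. \<Prod>a\<in>#M. 1 - fps_X ^ a :: rat fps"
  fix b
  show "count M b = count N b"
  proof (induction b rule: less_induct)
    case (less b)
    show ?case
    proof (cases "b = 0")
      case True
      then show ?thesis using assms(2,3) by (simp add: not_in_iff)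
    next
      case False
      let ?L = "filter_mset (\<lambda>a. a < b)" and ?U = "filter_mset (\<lambda>a. \<not> a < b)"
      have L: "?L M = ?L N" using less by (intro multiset_eqI) simp
      have split: "?P A = ?P (?L A) * ?P (?U A)" for A
      proof -
        have "?P A = ?P (?L A + ?U A)" by (rule arg_cong[OF multiset_partition])
        also have "\<dots> = ?P (?L A) * ?P (?U A)" by (simp only: image_mset_union prod_mset_Un)
        finally show ?thesis .
      qed
      have "fps_nth (?P (?L N)) 0 = 1"
        using fps_nth_euler_product[of "?L N" 1 0] assms(3) by (fastforce intro: Suc_leI gr0I)
      then have "?P (?L N) \<noteq> 0" by (metis fps_zero_nth zero_neq_one)
      moreover have "?P (?L N) * ?P (?U M) = ?P (?L N) * ?P (?U N)"
        using assms(1) split[of M] split[of N] L by simp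
      ultimately have "?P (?U M) = ?P (?U N)" by simp
      moreover have "fps_nth (?P (?U A)) b = - of_nat (count A b)" for A
        using fps_nth_euler_product[of "?U A" b b] False by simp
      ultimately have "(of_nat (count M b) :: rat) = of_nat (count N b)" by (metis neg_equal_iff_equal)
      then show ?thesis by simp
    qed
  qed
qed

lemma partitions_eqI:
  assumes "\<mu> \<in> partitions n" "\<nu> \<in> partitions n" "mset \<mu> = mset \<nu>"
  shows "\<mu> = \<nu>"
proof -
  have "sorted (rev \<mu>)" "sorted (rev \<nu>)"
    using assms(1,2) by (simp_all add: partitions_def sorted_wrt_rev)
  then have "rev \<mu> = rev \<nu>" using assms(3) by (metis mset_rev properties_for_sort)
  then show ?thesis by simp
qed

lemma zeta_S_separates_partitions:
  assumes "\<mu> \<in> partitions n" "\<nu> \<in> partitions n" "\<mu> \<noteq> \<nu>"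
  obtains m where "zeta_S n m (coxeter_element n \<mu>) \<noteq> zeta_S n m (coxeter_element n \<nu>)"
proof (rule ccontr)
  let ?P = "\<lambda>M. \<Prod>a\<in>#M. 1 - fps_X ^ a :: rat fps"
  assume "\<not> thesis"
  with that have "sym_series {1..n} (coxeter_element n \<mu>) = sym_series {1..n} (coxeter_element n \<nu>)"
    by (auto simp: fps_eq_iff zeta_S_eq)
  then obtain S where S: "S * ?P (mset \<mu>) = 1" "S * ?P (mset \<nu>) = 1"
    using sym_series_coxeter_element[OF assms(1)] sym_series_coxeter_element[OF assms(2)] by simp
  have "?P (mset \<mu>) = ?P (mset \<mu>) * (S * ?P (mset \<nu>))" by (simp add: S(2))
  also have "\<dots> = (S * ?P (mset \<mu>)) * ?P (mset \<nu>)" by (simp only: mult_ac)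
  finally have "?P (mset \<mu>) = ?P (mset \<nu>)" by (simp only: S(1) mult_1_left)
  then have "mset \<mu> = mset \<nu>"
    using assms(1,2) by (intro euler_product_inject) (auto simp: partitions_def)
  with assms partitions_eqI show False by blast
qed


section \<open>Characters of rational representations\<close>

text \<open>Matrix representations with an arbitrary finite index set, so that diagonal blocks
  (subsets of the index set) and tensor products (cartesian products) can be formed without
  renumbering.\<close>

definition index_rep ::
    "nat \<Rightarrow> 'i set \<Rightarrow> ((nat \<Rightarrow> nat) \<Rightarrow> 'i \<Rightarrow> 'i \<Rightarrow> 'a::field) \<Rightarrow> bool" where
  "index_rep n J M \<longleftrightarrow> finite J \<and> (\<forall>i\<in>J. \<forall>j\<in>J. M id i j = (if i = j then 1 else 0)) \<and>
     (\<forall>u\<in>Sym n. \<forall>w\<in>Sym n. \<forall>i\<in>J. \<forall>j\<in>J. M (u \<circ> w) i j = (\<Sum>k\<in>J. M u i k * M w k j))"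

lemma index_mult_mat_sum:
  assumes "A \<in> carrier_mat r d" "B \<in> carrier_mat d c" "i < r" "j < c"
  shows "(A * B) $$ (i, j) = (\<Sum>k<d. A $$ (i, k) * B $$ (k, j))"
  using assms by (auto simp: scalar_prod_def lessThan_atLeast0 intro!: sum.cong)

lemma index_rep_imp_symmetric_group_rep:
  assumes "index_rep n J M"
  obtains R where "symmetric_group_rep n (card J) R"
    and "\<And>w. matrix_trace (R w) = (\<Sum>i\<in>J. M w i i)"
proof -
  let ?d = "card J"
  have fin: "finite J" using assms by (simp add: index_rep_def)
  obtain e where e: "bij_betw e {..<?d} J"
    using ex_bij_betw_nat_finite[OF fin] by (auto simp: lessThan_atLeast0)
  have eJ: "e a \<in> J" if "a < ?d" for a using e that by (auto simp: bij_betw_def)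
  have e_eq: "e a = e b \<longleftrightarrow> a = b" if "a < ?d" "b < ?d" for a b
    using e that by (auto simp: bij_betw_def inj_on_def)
  define R where "R = (\<lambda>w. mat ?d ?d (\<lambda>(a, b). M w (e a) (e b)))"
  have R: "R w \<in> carrier_mat ?d ?d" for w by (simp add: R_def)
  have R_index: "R w $$ (a, b) = M w (e a) (e b)" if "a < ?d" "b < ?d" for w a b
    using that by (simp add: R_def)
  have "R id = 1\<^sub>m ?d"
    using assms by (intro eq_matI) (auto simp: R_def eJ e_eq index_rep_def)
  moreover have "R (u \<circ> w) = R u * R w" if "u \<in> Sym n" "w \<in> Sym n" for u w
  proof (rule eq_matI)
    show "dim_row (R (u \<circ> w)) = dim_row (R u * R w)" "dim_col (R (u \<circ> w)) = dim_col (R u * R w)"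
      by (simp_all add: R_def)
    fix a b assume "a < dim_row (R u * R w)" "b < dim_col (R u * R w)"
    then have ab: "a < ?d" "b < ?d" by (simp_all add: R_def)
    have "R (u \<circ> w) $$ (a, b) = (\<Sum>k\<in>J. M u (e a) k * M w k (e b))"
      using assms that eJ ab by (simp add: R_index index_rep_def)
    also have "\<dots> = (\<Sum>k<?d. M u (e a) (e k) * M w (e k) (e b))"
      by (rule sum.reindex_bij_betw[OF e, symmetric])
    also have "\<dots> = (\<Sum>k<?d. R u $$ (a, k) * R w $$ (k, b))"
      using ab by (intro sum.cong) (simp_all add: R_index)
    also have "\<dots> = (R u * R w) $$ (a, b)" using index_mult_mat_sum[OF R R ab] by simp
    finally show "R (u \<circ> w) $$ (a, b) = (R u * R w) $$ (a, b)" .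
  qed
  ultimately have "symmetric_group_rep n ?d R"
    using R by (simp add: symmetric_group_rep_def)
  moreover have "matrix_trace (R w) = (\<Sum>i\<in>J. M w i i)" for w
  proof -
    have "matrix_trace (R w) = (\<Sum>a<?d. M w (e a) (e a))"
      unfolding matrix_trace_def by (rule sum.cong) (simp_all add: R_def)
    also have "\<dots> = (\<Sum>i\<in>J. M w i i)" by (rule sum.reindex_bij_betw[OF e])
    finally show ?thesis .
  qed
  ultimately show thesis using that by blast
qed

lemma symmetric_group_rep_imp_index_rep:
  assumes "symmetric_group_rep n d R"
  shows "index_rep n {..<d} (\<lambda>w i j. R w $$ (i, j))"
    and "\<And>w. w \<in> Sym n \<Longrightarrow> matrix_trace (R w) = (\<Sum>i<d. R w $$ (i, i))"
proof -
  have R: "R w \<in> carrier_mat d d" if "w \<in> Sym n" for w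
    using assms that by (simp add: symmetric_group_rep_def)
  have "R id = 1\<^sub>m d" "\<forall>u\<in>Sym n. \<forall>w\<in>Sym n. R (u \<circ> w) = R u * R w"
    using assms by (simp_all add: symmetric_group_rep_def)
  then show "index_rep n {..<d} (\<lambda>w i j. R w $$ (i, j))"
    unfolding index_rep_def using index_mult_mat_sum[OF R R] by simp
  show "matrix_trace (R w) = (\<Sum>i<d. R w $$ (i, i))" if "w \<in> Sym n" for w
    using R[OF that] by (simp add: matrix_trace_def)
qed

lemma matrix_trace_mult_commute:
  fixes A B :: "'a::comm_semiring_0 mat"
  assumes "A \<in> carrier_mat d d" "B \<in> carrier_mat d d"
  shows "matrix_trace (A * B) = matrix_trace (B * A)"
proof -
  have trace: "matrix_trace (A * B) = (\<Sum>i<d. \<Sum>k<d. A $$ (i, k) * B $$ (k, i))"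
    if "A \<in> carrier_mat d d" "B \<in> carrier_mat d d" for A B :: "'a mat"
  proof -
    have "dim_row (A * B) = d" using that(1) by auto
    then show ?thesis unfolding matrix_trace_def
      by (intro sum.cong) (simp_all add: index_mult_mat_sum[OF that] del: index_mult_mat)
  qed
  show ?thesis
    unfolding trace[OF assms] trace[OF assms(2,1)] by (subst sum.swap) (simp add: mult.commute)
qed

section \<open>Splitting a reducible representation\<close>

lemma mult_mat_vec_in_subspace:
  fixes P :: "'a::field mat"
  assumes P: "P \<in> carrier_mat d d" and cols: "\<And>j. j < d \<Longrightarrow> col P j \<in> W"
    and zero: "0\<^sub>v d \<in> W" and add: "\<And>v w. v \<in> W \<Longrightarrow> w \<in> W \<Longrightarrow> v + w \<in> W"
    and smult: "\<And>a v. v \<in> W \<Longrightarrow> a \<cdot>\<^sub>v v \<in> W" and c: "c \<in> carrier_vec d"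
  shows "P *\<^sub>v c \<in> W"
proof -
  \<comment> \<open>The coordinates from \<open>m\<close> on are replaced by 0, so that each
    induction step adds a multiple of one column.\<close>
  let ?c = "\<lambda>m. vec d (\<lambda>i. if i < m then vec_index c i else 0)"
  have "P *\<^sub>v ?c m \<in> W" if "m \<le> d" for m
    using that
  proof (induction m)
    case 0
    have "P *\<^sub>v ?c 0 = 0\<^sub>v d" using P by (intro eq_vecI) (auto simp: scalar_prod_def)
    then show ?case using zero by simp
  next
    case (Suc m)
    have "P *\<^sub>v ?c (Suc m) = P *\<^sub>v ?c m + vec_index c m \<cdot>\<^sub>v col P m"
    proof (rule eq_vecI)
      show "dim_vec (P *\<^sub>v ?c (Suc m)) = dim_vec (P *\<^sub>v ?c m + vec_index c m \<cdot>\<^sub>v col P m)"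
        using P by simp
      fix i assume "i < dim_vec (P *\<^sub>v ?c m + vec_index c m \<cdot>\<^sub>v col P m)"
      then have i: "i < d" using P by simp
      have eq: "vec_index (P *\<^sub>v ?c k) i = (\<Sum>j<d. P $$ (i, j) * (if j < k then vec_index c j else 0))" for k
        using P i by (simp add: scalar_prod_def lessThan_atLeast0)
      have "vec_index (P *\<^sub>v ?c (Suc m)) i =
            (\<Sum>j<d. P $$ (i, j) * (if j < m then vec_index c j else 0) + (if j = m then P $$ (i, m) * vec_index c m else 0))"
        unfolding eq by (intro sum.cong) (auto simp: less_Suc_eq)
      also have "\<dots> = vec_index (P *\<^sub>v ?c m) i + P $$ (i, m) * vec_index c m"
        unfolding eq sum.distrib using Suc.prems by (simp add: sum.delta')
      finally show "vec_index (P *\<^sub>v ?c (Suc m)) i = vec_index (P *\<^sub>v ?c m + vec_index c m \<cdot>\<^sub>v col P m) i"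
        using P i Suc.prems by (simp add: mult.commute)
    qed
    then show ?case using Suc cols by (simp add: add smult)
  qed
  from this[of d] have "P *\<^sub>v ?c d \<in> W" by simp
  moreover have "?c d = c" using c by (intro eq_vecI) auto
  ultimately show ?thesis by simp
qed

text \<open>
  An invertible matrix with the largest possible number of columns in the subspace \<open>W\<close>; by
  Cramer's rule another column could be replaced by any vector of \<open>W\<close> outside their span.
\<close>

lemma adapted_basis:
  fixes W :: "'a::field vec set"
  assumes "W \<subseteq> carrier_vec d"
  obtains P Q where "P \<in> carrier_mat d d" "Q \<in> carrier_mat d d" "P * Q = 1\<^sub>m d" "Q * P = 1\<^sub>m d"
    and "\<And>x j. x \<in> W \<Longrightarrow> j < d \<Longrightarrow> col P j \<notin> W \<Longrightarrow> vec_index (Q *\<^sub>v x) j = 0"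
proof -
  let ?N = "\<lambda>P. card {j. j < d \<and> col P j \<in> W}"
  have "?N P < Suc d" for P
  proof -
    have "?N P \<le> card {..<d}" by (intro card_mono) auto
    then show ?thesis by simp
  qed
  then have "\<exists>P. (P \<in> carrier_mat d d \<and> det P \<noteq> 0) \<and>
      (\<forall>P'. P' \<in> carrier_mat d d \<and> det P' \<noteq> 0 \<longrightarrow> ?N P' \<le> ?N P)"
    by (intro ex_has_greatest_nat[of _ "1\<^sub>m d" _ "Suc d"]) auto
  then obtain P where P: "P \<in> carrier_mat d d" "det P \<noteq> 0"
    and max: "\<And>P'. P' \<in> carrier_mat d d \<Longrightarrow> det P' \<noteq> 0 \<Longrightarrow> ?N P' \<le> ?N P"
    by blast
  obtain Q where Q: "Q \<in> carrier_mat d d" "P * Q = 1\<^sub>m d" "Q * P = 1\<^sub>m d"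
    using det_non_zero_imp_unit[OF P] by (auto simp: Units_def ring_mat_simps)
  have "vec_index (Q *\<^sub>v x) j = 0" if x: "x \<in> W" and j: "j < d" "col P j \<notin> W" for x j
  proof (rule ccontr)
    let ?c = "Q *\<^sub>v x"
    assume neq: "vec_index ?c j \<noteq> 0"
    have x': "x \<in> carrier_vec d" using x assms by auto
    have c: "?c \<in> carrier_vec d" using Q(1) x' by auto
    have Pc: "P *\<^sub>v ?c = x"
      using assoc_mult_mat_vec[OF P(1) Q(1) x'] Q(2) x' by simp
    define P' where "P' = replace_col P x j"
    have P': "P' \<in> carrier_mat d d" using P(1) by (simp add: P'_def replace_col_def)
    have "det P' = vec_index ?c j * det P"
      unfolding P'_def using cramer_lemma_mat[OF P(1) c j(1)] Pc by simp
    then have "?N P' \<le> ?N P" using neq P(2) max P' by simp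
    have col_j: "col P' j = x"
      using P(1) x' j(1) by (intro eq_vecI) (auto simp: P'_def replace_col_def)
    have col_k: "col P' k = col P k" if "k < d" "k \<noteq> j" for k
      using P(1) that by (intro eq_vecI) (auto simp: P'_def replace_col_def)
    have "k < d \<and> col P' k \<in> W" if "k \<in> insert j {j. j < d \<and> col P j \<in> W}" for k
      using that x j(1) col_j col_k[of k] by (cases "k = j") auto
    then have "insert j {j. j < d \<and> col P j \<in> W} \<subseteq> {j. j < d \<and> col P' j \<in> W}" by blast
    then have "card (insert j {j. j < d \<and> col P j \<in> W}) \<le> ?N P'"
      by (intro card_mono) auto
    then show False using \<open>?N P' \<le> ?N P\<close> j(2) by simp
  qed
  then show thesis using that P(1) Q by blast
qed


text \<open>In a basis adapted to an invariant subspace all matrices become block triangular, with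
  \<open>J\<close> indexing the basis vectors inside the subspace. The diagonal blocks are the
  subrepresentation and the quotient; the trace is the sum of theirs.\<close>

lemma reducible_rep_splits:
  fixes R :: "(nat \<Rightarrow> nat) \<Rightarrow> 'a::field mat"
  assumes rep: "symmetric_group_rep n d R" and "d > 0" "\<not> irreducible_family (Sym n) d R"
  obtains J M where "J \<subset> {..<d}" "J \<noteq> {}" "index_rep n J M" "index_rep n ({..<d} - J) M"
    and "\<And>w. w \<in> Sym n \<Longrightarrow> matrix_trace (R w) = (\<Sum>i<d. M w i i)"
proof -
  obtain W where W: "VectorSpace.subspace class_ring W (module_vec TYPE('a) d)"
    and inv: "\<And>w v. w \<in> Sym n \<Longrightarrow> v \<in> W \<Longrightarrow> R w *\<^sub>v v \<in> W"
    and proper: "W \<noteq> {0\<^sub>v d}" "W \<noteq> carrier_vec d"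
    using assms(2,3) unfolding irreducible_family_def by blast
  interpret submodule class_ring W "module_vec TYPE('a) d"
    using W by (simp add: VectorSpace.subspace_def)
  have sub: "W \<subseteq> carrier_vec d" and zero: "0\<^sub>v d \<in> W"
    and add: "\<And>v w. v \<in> W \<Longrightarrow> w \<in> W \<Longrightarrow> v + w \<in> W"
    and smult: "\<And>a v. v \<in> W \<Longrightarrow> a \<cdot>\<^sub>v v \<in> W"
    using subset zero_closed m_closed smult_closed by (simp_all add: module_vec_simps class_ring_simps)
  obtain P Q where P: "P \<in> carrier_mat d d" and Q: "Q \<in> carrier_mat d d"
    and PQ: "P * Q = 1\<^sub>m d" and QP: "Q * P = 1\<^sub>m d"
    and coord: "\<And>x j. x \<in> W \<Longrightarrow> j < d \<Longrightarrow> col P j \<notin> W \<Longrightarrow> vec_index (Q *\<^sub>v x) j = 0"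
    by (rule adapted_basis[OF sub]) blast
  have PQv: "P *\<^sub>v (Q *\<^sub>v x) = x" if "x \<in> carrier_vec d" for x
    using assoc_mult_mat_vec[OF P Q that] PQ that by simp
  have R: "R w \<in> carrier_mat d d" if "w \<in> Sym n" for w
    using rep that by (simp add: symmetric_group_rep_def)
  define J where "J = {j. j < d \<and> col P j \<in> W}"
  define B where "B = (\<lambda>w. Q * R w * P)"
  define M where "M = (\<lambda>w i j. B w $$ (i, j))"
  have B: "B w \<in> carrier_mat d d" if "w \<in> Sym n" for w
    unfolding B_def using P Q R[OF that] by auto
  have J_sub: "J \<subseteq> {..<d}" by (auto simp: J_def)
  have "J \<noteq> {}"
  proof
    assume "J = {}"
    have "x = 0\<^sub>v d" if x: "x \<in> W" for x
    proof -
      have xc: "x \<in> carrier_vec d" using x sub by auto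
      have "vec_index (Q *\<^sub>v x) j = 0" if "j < d" for j
        using coord[OF x that] \<open>J = {}\<close> that by (auto simp: J_def)
      then have "Q *\<^sub>v x = 0\<^sub>v d" using Q by (intro eq_vecI) auto
      then have "x = P *\<^sub>v 0\<^sub>v d" using PQv[OF xc] by simp
      also have "\<dots> = 0\<^sub>v d" using P by (intro eq_vecI) auto
      finally show ?thesis .
    qed
    with zero proper(1) show False by blast
  qed
  moreover have "J \<noteq> {..<d}"
  proof
    assume "J = {..<d}"
    then have cols: "col P j \<in> W" if "j < d" for j using that by (auto simp: J_def)
    have "x \<in> W" if "x \<in> carrier_vec d" for x
    proof -
      have "Q *\<^sub>v x \<in> carrier_vec d" using Q that by auto
      from mult_mat_vec_in_subspace[OF P cols zero add smult this] show ?thesis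
        using PQv[OF that] by simp
    qed
    with sub proper(2) show False by blast
  qed
  moreover have "finite J" using J_sub finite_subset by blast
  \<comment> \<open>By invariance \<open>R w\<close> sends the basis vector \<open>col P j\<close>
    back into \<open>W\<close>, where the coordinates outside \<open>J\<close> vanish.\<close>
  have block: "M w i j = 0" if "w \<in> Sym n" "i < d" "i \<notin> J" "j \<in> J" for w i j
  proof -
    have j: "j < d" "col P j \<in> W" using that(4) by (auto simp: J_def)
    have "B w = Q * (R w * P)" unfolding B_def using P Q R[OF that(1)] by simp
    then have "M w i j = vec_index (col (Q * (R w * P)) j) i"
      using that(2) j(1) P Q by (simp add: M_def)
    also have "col (Q * (R w * P)) j = Q *\<^sub>v (R w *\<^sub>v col P j)"
      using P Q R[OF that(1)] j(1) by (metis col_mult2 mult_carrier_mat)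
    finally show ?thesis
      using coord[OF inv[OF that(1) j(2)] that(2)] that(2,3) by (simp add: J_def)
  qed
  have M_id: "M id i j = (if i = j then 1 else 0)" if "i < d" "j < d" for i j
  proof -
    have "R id = 1\<^sub>m d" using rep by (simp add: symmetric_group_rep_def)
    then have "B id = 1\<^sub>m d" unfolding B_def using Q QP by simp
    then show ?thesis using that by (simp add: M_def)
  qed
  have M_comp: "M (u \<circ> w) i j = (\<Sum>k<d. M u i k * M w k j)"
    if uw: "u \<in> Sym n" "w \<in> Sym n" and ij: "i < d" "j < d" for u w i j
  proof -
    have "R (u \<circ> w) = R u * R w" using rep uw by (simp add: symmetric_group_rep_def)
    also have "\<dots> = R u * ((P * Q) * R w)" using R[OF uw(2)] PQ by simp
    finally have "B (u \<circ> w) = Q * (R u * ((P * Q) * R w)) * P" by (simp add: B_def)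
    also have "\<dots> = B u * B w"
      unfolding B_def using P Q R[OF uw(1)] R[OF uw(2)]
      by (simp add: assoc_mult_mat[of _ d d _ d _ d])
    finally show ?thesis using index_mult_mat_sum[OF B[OF uw(1)] B[OF uw(2)] ij] by (simp add: M_def)
  qed
  have "index_rep n J M"
    unfolding index_rep_def
  proof (intro conjI ballI)
    fix u w i j assume uw: "u \<in> Sym n" "w \<in> Sym n" and ij: "i \<in> J" "j \<in> J"
    \<comment> \<open>An intermediate index outside \<open>J\<close> is killed by the second factor,
      whose column lies in \<open>J\<close>.\<close>
    have "(\<Sum>k<d. M u i k * M w k j) = (\<Sum>k\<in>J. M u i k * M w k j)"
      by (rule sum.mono_neutral_right) (use J_sub block uw ij in auto)
    then show "M (u \<circ> w) i j = (\<Sum>k\<in>J. M u i k * M w k j)"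
      using M_comp[OF uw] ij J_sub by (metis lessThan_iff subsetD)
  qed (use \<open>finite J\<close> M_id in \<open>auto simp: J_def\<close>)
  moreover have "index_rep n ({..<d} - J) M"
    unfolding index_rep_def
  proof (intro conjI ballI)
    fix u w i j assume uw: "u \<in> Sym n" "w \<in> Sym n" and ij: "i \<in> {..<d} - J" "j \<in> {..<d} - J"
    \<comment> \<open>Here an intermediate index inside \<open>J\<close> is killed by the first
      factor, whose row lies outside \<open>J\<close>.\<close>
    have "(\<Sum>k<d. M u i k * M w k j) = (\<Sum>k\<in>{..<d} - J. M u i k * M w k j)"
      by (rule sum.mono_neutral_right) (use J_sub block uw ij in auto)
    then show "M (u \<circ> w) i j = (\<Sum>k\<in>{..<d} - J. M u i k * M w k j)"
      using M_comp[OF uw] ij by (metis DiffD1 lessThan_iff)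
  qed (use M_id in auto)
  moreover have "matrix_trace (R w) = (\<Sum>i<d. M w i i)" if "w \<in> Sym n" for w
  proof -
    have "(\<Sum>i<d. M w i i) = matrix_trace (Q * (R w * P))"
      using P Q R[OF that] B[OF that] by (simp add: matrix_trace_def M_def B_def)
    also have "\<dots> = matrix_trace ((R w * P) * Q)"
      by (rule matrix_trace_mult_commute[OF Q]) (use P R[OF that] in auto)
    also have "(R w * P) * Q = R w" using P Q R[OF that] PQ by simp
    finally show ?thesis by simp
  qed
  ultimately show thesis using that J_sub by blast
qed


section \<open>The span of the irreducible characters\<close>

definition char_span :: "nat \<Rightarrow> (nat list \<Rightarrow> (nat \<Rightarrow> nat) \<Rightarrow> rat) \<Rightarrow> ((nat \<Rightarrow> nat) \<Rightarrow> rat) set" where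
  "char_span n chi = {f. \<exists>c. \<forall>w\<in>Sym n. f w = (\<Sum>\<mu>\<in>partitions n. c \<mu> * chi \<mu> w)}"

lemma char_spanI:
  assumes "\<And>w. w \<in> Sym n \<Longrightarrow> f w = (\<Sum>\<mu>\<in>partitions n. c \<mu> * chi \<mu> w)"
  shows "f \<in> char_span n chi"
  using assms unfolding char_span_def by blast

lemma finite_partitions: "finite (partitions n)"
proof (rule finite_subset)
  have "length \<mu> \<le> sum_list \<mu>" if "\<forall>a\<in>set \<mu>. 0 < a" for \<mu> :: "nat list"
    using that by (induction \<mu>) (auto simp: Suc_le_eq)
  then show "partitions n \<subseteq> {\<mu>. set \<mu> \<subseteq> {..n} \<and> length \<mu> \<le> n}"
    using partitionsD member_le_sum_list by fastforce
  show "finite {\<mu>. set \<mu> \<subseteq> {..n} \<and> length \<mu> \<le> n}" by (intro finite_lists_length_le) simp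
qed

lemma char_span_cong:
  assumes "f \<in> char_span n chi" "\<And>w. w \<in> Sym n \<Longrightarrow> g w = f w"
  shows "g \<in> char_span n chi"
  using assms by (simp add: char_span_def)

lemma char_span_add:
  assumes "f \<in> char_span n chi" "g \<in> char_span n chi"
  shows "(\<lambda>w. f w + g w) \<in> char_span n chi"
proof -
  obtain c e where "\<forall>w\<in>Sym n. f w = (\<Sum>\<mu>\<in>partitions n. c \<mu> * chi \<mu> w)"
    "\<forall>w\<in>Sym n. g w = (\<Sum>\<mu>\<in>partitions n. e \<mu> * chi \<mu> w)"
    using assms by (auto simp: char_span_def)
  then have "\<forall>w\<in>Sym n. f w + g w = (\<Sum>\<mu>\<in>partitions n. (c \<mu> + e \<mu>) * chi \<mu> w)"
    by (simp add: distrib_right sum.distrib)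
  then show ?thesis by (intro char_spanI) simp
qed

lemma char_span_scale:
  assumes "f \<in> char_span n chi"
  shows "(\<lambda>w. a * f w) \<in> char_span n chi"
proof -
  obtain c where "\<forall>w\<in>Sym n. f w = (\<Sum>\<mu>\<in>partitions n. c \<mu> * chi \<mu> w)"
    using assms by (auto simp: char_span_def)
  then have "\<forall>w\<in>Sym n. a * f w = (\<Sum>\<mu>\<in>partitions n. (a * c \<mu>) * chi \<mu> w)"
    by (simp add: sum_distrib_left mult.assoc)
  then show ?thesis by (intro char_spanI) simp
qed

lemma char_span_zero: "(\<lambda>w. 0) \<in> char_span n chi"
  unfolding char_span_def by (intro CollectI exI[of _ "\<lambda>_. 0"]) simp

lemma char_span_sum:
  assumes "\<And>i. i \<in> I \<Longrightarrow> f i \<in> char_span n chi"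
  shows "(\<lambda>w. \<Sum>i\<in>I. f i w) \<in> char_span n chi"
  using assms
  by (induction I rule: infinite_finite_induct) (simp_all add: char_span_zero char_span_add)

lemma char_span_chi:
  assumes "\<mu> \<in> partitions n"
  shows "chi \<mu> \<in> char_span n chi"
  unfolding char_span_def
proof (intro CollectI exI[of _ "\<lambda>\<nu>. if \<nu> = \<mu> then 1 else 0"] ballI)
  fix w
  have "(\<Sum>\<nu>\<in>partitions n. (if \<nu> = \<mu> then 1 else 0) * chi \<nu> w) =
        (\<Sum>\<nu>\<in>partitions n. if \<nu> = \<mu> then chi \<nu> w else 0)"
    by (rule sum.cong) auto
  then show "chi \<mu> w = (\<Sum>\<nu>\<in>partitions n. (if \<nu> = \<mu> then 1 else 0) * chi \<nu> w)"
    using assms finite_partitions by simp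
qed

text \<open>Strong induction on the dimension. The character of an irreducible representation is one
  of the \<open>chi \<mu>\<close>, since these exhaust \<open>symmetric_group_irr n\<close>; a
  reducible one has the sum of two characters of smaller dimension.\<close>

lemma symmetric_group_rep_in_char_span:
  assumes "symmetric_group_characters n chi"
    and "symmetric_group_rep n d (R :: (nat \<Rightarrow> nat) \<Rightarrow> rat mat)"
  shows "(\<lambda>w. matrix_trace (R w)) \<in> char_span n chi"
  using assms(2)
proof (induction d arbitrary: R rule: less_induct)
  case (less d)
  have dim: "R w \<in> carrier_mat d d" if "w \<in> Sym n" for w
    using less.prems that by (simp add: symmetric_group_rep_def)
  consider "d = 0" | "irreducible_family (Sym n) d R" | "d > 0" "\<not> irreducible_family (Sym n) d R"
    by auto
  then show ?case
  proof cases
    case 1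
    show ?thesis
    proof (rule char_span_cong[OF char_span_zero])
      fix w assume "w \<in> Sym n"
      then have "dim_row (R w) = 0" using dim 1 by blast
      then show "matrix_trace (R w) = 0" by (simp add: matrix_trace_def)
    qed
  next
    case 2
    then have "(\<lambda>w\<in>Sym n. matrix_trace (R w)) \<in> symmetric_group_irr n"
      using less.prems unfolding symmetric_group_irr_def by blast
    also have "symmetric_group_irr n = (\<lambda>\<mu>. restrict (chi \<mu>) (Sym n)) ` partitions n"
      using assms(1) by (simp add: symmetric_group_characters_def bij_betw_def)
    finally obtain \<mu> where \<mu>: "\<mu> \<in> partitions n"
      "(\<lambda>w\<in>Sym n. matrix_trace (R w)) = restrict (chi \<mu>) (Sym n)" by blast
    have "matrix_trace (R w) = chi \<mu> w" if "w \<in> Sym n" for w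
      using fun_cong[OF \<mu>(2), of w] that by simp
    then show ?thesis by (rule char_span_cong[OF char_span_chi[OF \<mu>(1)]])
  next
    case 3
    obtain J M where J: "J \<subset> {..<d}" "J \<noteq> {}" "index_rep n J M" "index_rep n ({..<d} - J) M"
      and trace: "\<And>w. w \<in> Sym n \<Longrightarrow> matrix_trace (R w) = (\<Sum>i<d. M w i i)"
      by (rule reducible_rep_splits[OF less.prems 3]) blast
    have span: "(\<lambda>w. \<Sum>i\<in>I. M w i i) \<in> char_span n chi"
      if I: "index_rep n I M" "I \<subset> {..<d}" for I
    proof -
      obtain R' where R': "symmetric_group_rep n (card I) R'"
        "\<And>w. matrix_trace (R' w) = (\<Sum>i\<in>I. M w i i)"
        using index_rep_imp_symmetric_group_rep[OF I(1)] by blast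
      have "card I < d" using psubset_card_mono[OF _ I(2)] by simp
      from less.IH[OF this R'(1)] show ?thesis using R'(2) by simp
    qed
    have "{..<d} - J \<subset> {..<d}" using J(1,2) by blast
    then have sum: "(\<lambda>w. (\<Sum>i\<in>J. M w i i) + (\<Sum>i\<in>{..<d} - J. M w i i)) \<in> char_span n chi"
      using span J by (intro char_span_add) auto
    have "(\<Sum>i<d. M w i i) = (\<Sum>i\<in>{..<d} - J. M w i i) + (\<Sum>i\<in>J. M w i i)" for w
      using J(1) by (intro sum.subset_diff) auto
    then show ?thesis
      by (intro char_span_cong[OF sum]) (simp add: trace)
  qed
qed

lemma index_rep_in_char_span:
  assumes "symmetric_group_characters n chi" "index_rep n J (M :: (nat \<Rightarrow> nat) \<Rightarrow> 'i \<Rightarrow> 'i \<Rightarrow> rat)"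
  shows "(\<lambda>w. \<Sum>i\<in>J. M w i i) \<in> char_span n chi"
proof -
  obtain R where "symmetric_group_rep n (card J) R"
    "\<And>w. matrix_trace (R w) = (\<Sum>i\<in>J. M w i i)"
    using index_rep_imp_symmetric_group_rep[OF assms(2)] by blast
  then show ?thesis using symmetric_group_rep_in_char_span[OF assms(1)] by fastforce
qed

text \<open>The tensor product of \<open>M\<close> with the permutation representation on
  \<open>\<Omega>\<close>. In a matrix product only the intermediate point \<open>act w y\<close>
  contributes.\<close>

lemma index_rep_permutation_tensor:
  fixes act :: "(nat \<Rightarrow> nat) \<Rightarrow> 'o \<Rightarrow> 'o"
  assumes M: "index_rep n J M" and fin: "finite \<Omega>"
    and act_in: "\<And>w x. w \<in> Sym n \<Longrightarrow> x \<in> \<Omega> \<Longrightarrow> act w x \<in> \<Omega>"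
    and act_id: "\<And>x. x \<in> \<Omega> \<Longrightarrow> act id x = x"
    and act_comp: "\<And>u w x. u \<in> Sym n \<Longrightarrow> w \<in> Sym n \<Longrightarrow> x \<in> \<Omega> \<Longrightarrow> act (u \<circ> w) x = act u (act w x)"
  shows "index_rep n (\<Omega> \<times> J)
           (\<lambda>w a b. if fst a = act w (fst b) then M w (snd a) (snd b) else 0)"
proof -
  have J: "finite J" "\<And>i j. i \<in> J \<Longrightarrow> j \<in> J \<Longrightarrow> M id i j = (if i = j then 1 else 0)"
    "\<And>u w i j. u \<in> Sym n \<Longrightarrow> w \<in> Sym n \<Longrightarrow> i \<in> J \<Longrightarrow> j \<in> J \<Longrightarrow>
       M (u \<circ> w) i j = (\<Sum>k\<in>J. M u i k * M w k j)"
    using M by (simp_all add: index_rep_def)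
  have "(\<Sum>c\<in>\<Omega> \<times> J. (if x = act u (fst c) then M u i (snd c) else 0) *
          (if fst c = act w y then M w (snd c) j else 0)) =
        (if x = act (u \<circ> w) y then M (u \<circ> w) i j else 0)"
    if uw: "u \<in> Sym n" "w \<in> Sym n" and xy: "x \<in> \<Omega>" "y \<in> \<Omega>" and ij: "i \<in> J" "j \<in> J" for u w x y i j
  proof -
    have "(\<Sum>c\<in>\<Omega> \<times> J. (if x = act u (fst c) then M u i (snd c) else 0) *
            (if fst c = act w y then M w (snd c) j else 0)) =
          (\<Sum>z\<in>\<Omega>. if z = act w y then (\<Sum>k\<in>J. (if x = act u z then M u i k else 0) * M w k j) else 0)"
      unfolding sum.cartesian_product' fst_conv snd_conv by (intro sum.cong refl) auto
    also have "\<dots> = (\<Sum>k\<in>J. (if x = act u (act w y) then M u i k else 0) * M w k j)"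
      using act_in[OF uw(2) xy(2)] fin by simp
    also have "\<dots> = (if x = act (u \<circ> w) y then M (u \<circ> w) i j else 0)"
      unfolding act_comp[OF uw xy(2)] J(3)[OF uw ij] by simp
    finally show ?thesis .
  qed
  then show ?thesis
    unfolding index_rep_def using J(1,2) fin act_id by (auto simp: prod_eq_iff)
qed

text \<open>The product is the character of the m-th symmetric power tensored with a representation
  affording \<open>chi \<mu>\<close>; the diagonal of the permutation factor picks out the fixed
  multisets.\<close>

lemma zeta_S_mult_chi_in_char_span:
  assumes "symmetric_group_characters n chi" "\<mu> \<in> partitions n"
  shows "(\<lambda>w. zeta_S n m w * chi \<mu> w) \<in> char_span n chi"
proof -
  have "restrict (chi \<mu>) (Sym n) \<in> symmetric_group_irr n"
    using assms unfolding symmetric_group_characters_def bij_betw_def by blast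
  then obtain d R where R: "symmetric_group_rep n d R"
    and chi: "restrict (chi \<mu>) (Sym n) = (\<lambda>w\<in>Sym n. matrix_trace (R w))"
    unfolding symmetric_group_irr_def by blast
  have chi_eq: "chi \<mu> w = (\<Sum>i<d. R w $$ (i, i))" if "w \<in> Sym n" for w
    using fun_cong[OF chi, of w] symmetric_group_rep_imp_index_rep(2)[OF R that] that by simp
  let ?\<Omega> = "multisets_of_size {1..n} m"
  let ?M = "\<lambda>w a b. if fst a = image_mset w (fst b) then R w $$ (snd a, snd b) else 0"
  have fin: "finite ?\<Omega>" by (rule finite_multisets_of_size) simp
  have "index_rep n (?\<Omega> \<times> {..<d}) ?M"
  proof (rule index_rep_permutation_tensor[OF symmetric_group_rep_imp_index_rep(1)[OF R] fin])
    fix w A assume "w \<in> Sym n" "A \<in> ?\<Omega>"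
    then show "image_mset w A \<in> ?\<Omega>"
      using permutes_image[of w "{1..n}"] by (auto simp: multisets_of_size_def Sym_def)
  qed (simp_all add: multiset.map_comp comp_def)
  then have span: "(\<lambda>w. \<Sum>a\<in>?\<Omega> \<times> {..<d}. ?M w a a) \<in> char_span n chi"
    by (rule index_rep_in_char_span[OF assms(1)])
  have "zeta_S n m w * chi \<mu> w = (\<Sum>a\<in>?\<Omega> \<times> {..<d}. ?M w a a)" if "w \<in> Sym n" for w
  proof -
    have "(\<Sum>a\<in>?\<Omega> \<times> {..<d}. ?M w a a) = (\<Sum>A\<in>?\<Omega>. if A = image_mset w A then chi \<mu> w else 0)"
      unfolding chi_eq[OF that] sum.cartesian_product' fst_conv snd_conv by (intro sum.cong refl) auto
    also have "\<dots> = (\<Sum>A | A \<in> ?\<Omega> \<and> A = image_mset w A. chi \<mu> w)"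
      by (rule sum.inter_filter[symmetric, OF fin])
    also have "{A. A \<in> ?\<Omega> \<and> A = image_mset w A} =
               {A. set_mset A \<subseteq> {1..n} \<and> size A = m \<and> image_mset w A = A}"
      unfolding multisets_of_size_def mem_Collect_eq by (intro Collect_cong) metis
    finally show ?thesis unfolding zeta_S_def by (simp only: sum_constant)
  qed
  then show ?thesis by (rule char_span_cong[OF span])
qed

lemma zeta_S_mult_in_char_span:
  assumes "symmetric_group_characters n chi" "f \<in> char_span n chi"
  shows "(\<lambda>w. zeta_S n m w * f w) \<in> char_span n chi"
proof -
  obtain c where c: "\<forall>w\<in>Sym n. f w = (\<Sum>\<mu>\<in>partitions n. c \<mu> * chi \<mu> w)"
    using assms(2) by (auto simp: char_span_def)
  have "(\<lambda>w. \<Sum>\<mu>\<in>partitions n. c \<mu> * (zeta_S n m w * chi \<mu> w)) \<in> char_span n chi"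
    by (intro char_span_sum char_span_scale zeta_S_mult_chi_in_char_span assms(1))
  then show ?thesis
    by (rule char_span_cong) (simp add: c sum_distrib_left mult_ac)
qed

lemma one_in_char_span:
  assumes "symmetric_group_characters n chi"
  shows "(\<lambda>w. 1) \<in> char_span n chi"
proof -
  have "index_rep n {0::nat} (\<lambda>w i j. 1)" by (simp add: index_rep_def)
  from index_rep_in_char_span[OF assms this] show ?thesis by simp
qed

text \<open>Comparing coefficients in \<open>sym_series * ext_series = 1\<close> gives e_k = [k = 0]
  - (sum over i = 1..k of h_i e_(k-i)), with h_i the character \<open>zeta_S n i\<close>. The span
  is closed under multiplication by each h_i, so induction on \<open>k\<close> applies.\<close>

lemma ext_series_mult_in_char_span:
  assumes "symmetric_group_characters n chi" "f \<in> char_span n chi"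
  shows "(\<lambda>w. fps_nth (ext_series {1..n} w) k * f w) \<in> char_span n chi"
proof (induction k rule: less_induct)
  case (less k)
  let ?E = "\<lambda>k w. fps_nth (ext_series {1..n} w) k"
  have "(\<lambda>w. (if k = 0 then 1 else 0) * f w +
          (- 1) * (\<Sum>i\<in>{1..k}. zeta_S n i w * (?E (k - i) w * f w))) \<in> char_span n chi"
    by (intro char_span_add char_span_scale char_span_sum zeta_S_mult_in_char_span[OF assms(1)]
        assms(2) less.IH) auto
  then show ?case
  proof (rule char_span_cong)
    fix w assume "w \<in> Sym n"
    then have w: "w permutes {1..n}" by (simp add: Sym_def)
    have "sym_series {1..n} w * ext_series {1..n} w = 1"
      by (rule sym_series_mult_ext_series[OF _ permutes_inj[OF w] permutes_image[OF w]]) simp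
    then have "(\<Sum>i=0..k. zeta_S n i w * ?E (k - i) w) = (if k = 0 then 1 else 0)"
      by (metis (no_types, lifting) fps_mult_nth fps_one_nth sum.cong zeta_S_eq)
    moreover have "zeta_S n 0 w = 1"
    proof -
      have "{A. set_mset A \<subseteq> {1..n} \<and> size A = 0 \<and> image_mset w A = A} = {{#}}" by auto
      then show ?thesis unfolding zeta_S_def by (simp only: card.insert finite.emptyI empty_iff) simp
    qed
    ultimately have "?E k w = (if k = 0 then 1 else 0) - (\<Sum>i=1..k. zeta_S n i w * ?E (k - i) w)"
      by (simp add: sum.atLeast_Suc_atMost)
    then have "?E k w * f w = (if k = 0 then 1 else 0) * f w
        - (\<Sum>i=1..k. zeta_S n i w * ?E (k - i) w) * f w"
      by (simp only: left_diff_distrib)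
    then show "?E k w * f w = (if k = 0 then 1 else 0) * f w +
          (- 1) * (\<Sum>i\<in>{1..k}. zeta_S n i w * (?E (k - i) w * f w))"
      by (simp only: sum_distrib_right mult.assoc mult_minus1 diff_conv_add_uminus)
  qed
qed


section \<open>Inverting the character table at the Coxeter elements\<close>

lemma finite_matrix_left_inverse_imp_right_inverse:
  fixes A B :: "'i \<Rightarrow> 'i \<Rightarrow> 'a::field"
  assumes fin: "finite P"
    and AB: "\<And>i j. i \<in> P \<Longrightarrow> j \<in> P \<Longrightarrow> (\<Sum>k\<in>P. A i k * B k j) = (if i = j then 1 else 0)"
    and ij: "i \<in> P" "j \<in> P"
  shows "(\<Sum>k\<in>P. B i k * A k j) = (if i = j then 1 else 0)"
proof -
  let ?d = "card P"
  obtain e where e: "bij_betw e {..<?d} P"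
    using ex_bij_betw_nat_finite[OF fin] by (auto simp: lessThan_atLeast0)
  have eP: "e a \<in> P" if "a < ?d" for a using e that by (auto simp: bij_betw_def)
  have e_eq: "e a = e b \<longleftrightarrow> a = b" if "a < ?d" "b < ?d" for a b
    using e that by (auto simp: bij_betw_def inj_on_def)
  define mt where "mt = (\<lambda>C :: 'i \<Rightarrow> 'i \<Rightarrow> 'a. mat ?d ?d (\<lambda>(a, b). C (e a) (e b)))"
  have mt: "mt C \<in> carrier_mat ?d ?d" for C by (simp add: mt_def)
  have prod: "(mt C * mt D) $$ (a, b) = (\<Sum>k\<in>P. C (e a) k * D k (e b))" if "a < ?d" "b < ?d" for C D a b
  proof -
    have "(mt C * mt D) $$ (a, b) = (\<Sum>k<?d. C (e a) (e k) * D (e k) (e b))"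
      unfolding index_mult_mat_sum[OF mt mt that] using that by (intro sum.cong) (simp_all add: mt_def)
    then show ?thesis by (simp only: sum.reindex_bij_betw[OF e, of "\<lambda>k. C (e a) k * D k (e b)"])
  qed
  have "mt A * mt B = 1\<^sub>m ?d"
  proof (rule eq_matI)
    fix a b assume "a < dim_row (1\<^sub>m ?d :: 'a mat)" "b < dim_col (1\<^sub>m ?d :: 'a mat)"
    then have "a < ?d" "b < ?d" by simp_all
    then show "(mt A * mt B) $$ (a, b) = 1\<^sub>m ?d $$ (a, b)"
      by (simp add: prod AB eP e_eq del: index_mult_mat)
  qed (simp_all add: mt_def)
  then have BA: "mt B * mt A = 1\<^sub>m ?d" by (rule mat_mult_left_right_inverse[OF mt mt])
  obtain a b where ab: "a < ?d" "b < ?d" "i = e a" "j = e b"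
    using ij bij_betw_imp_surj_on[OF e] by (metis imageE lessThan_iff)
  then show ?thesis using prod[OF ab(1,2), of B A] by (simp add: BA e_eq)
qed

abbreviation cox_char :: "nat \<Rightarrow> (nat list \<Rightarrow> (nat \<Rightarrow> nat) \<Rightarrow> rat) \<Rightarrow> nat list \<Rightarrow> nat list \<Rightarrow> rat" where
  "cox_char n chi \<mu> \<kappa> \<equiv> chi \<mu> (coxeter_element n \<kappa>)"

text \<open>Lagrange interpolation with the values of the characters \<open>\<zeta>\<^sub>S\<^sup>m\<close>.\<close>

lemma char_span_separates:
  assumes "symmetric_group_characters n chi" "\<kappa> \<in> partitions n" "S \<subseteq> partitions n - {\<kappa>}"
  shows "\<exists>f\<in>char_span n chi. f (coxeter_element n \<kappa>) = 1 \<and> (\<forall>\<nu>\<in>S. f (coxeter_element n \<nu>) = 0)"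
proof -
  have "finite S" using assms(3) finite_partitions finite_subset by blast
  then show ?thesis
    using assms(3)
  proof (induction S rule: finite_induct)
    case empty
    then show ?case using one_in_char_span[OF assms(1)] by auto
  next
    case (insert \<nu> S)
    then obtain f where f: "f \<in> char_span n chi" "f (coxeter_element n \<kappa>) = 1"
      "\<forall>\<nu>\<in>S. f (coxeter_element n \<nu>) = 0" by auto
    have "\<kappa> \<noteq> \<nu>" "\<nu> \<in> partitions n" using insert.prems by auto
    then obtain m where m: "zeta_S n m (coxeter_element n \<kappa>) \<noteq> zeta_S n m (coxeter_element n \<nu>)"
      using zeta_S_separates_partitions[OF assms(2)] by metis
    let ?z = "zeta_S n m"
    define a where "a = inverse (?z (coxeter_element n \<kappa>) - ?z (coxeter_element n \<nu>))"
    \<comment> \<open>This is \<open>f\<close> times the interpolation factor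
      \<open>a * (?z w - ?z (coxeter_element n \<nu>))\<close>, which is 1 at
      \<open>\<kappa>\<close> and 0 at \<open>\<nu>\<close>; it is expanded so that the closure
      properties of \<open>char_span\<close> apply.\<close>
    let ?g = "\<lambda>w. a * (?z w * f w) + (- a * ?z (coxeter_element n \<nu>)) * f w"
    have g: "?g w = a * (?z w - ?z (coxeter_element n \<nu>)) * f w" for w
      by (simp add: algebra_simps)
    have "?g \<in> char_span n chi"
      by (intro char_span_add char_span_scale zeta_S_mult_in_char_span[OF assms(1)] f(1))
    moreover have "?g (coxeter_element n \<kappa>) = 1"
    proof -
      have "a * (?z (coxeter_element n \<kappa>) - ?z (coxeter_element n \<nu>)) = 1"
        unfolding a_def using m by (intro left_inverse) simp
      then show ?thesis by (simp add: f(2) right_diff_distrib)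
    qed
    moreover have "\<forall>\<nu>'\<in>insert \<nu> S. ?g (coxeter_element n \<nu>') = 0"
      unfolding g using f(3) by auto
    ultimately show ?case by (intro bexI[of _ ?g] conjI)
  qed
qed

text \<open>Row \<open>\<kappa>\<close> of \<open>K\<close> holds the coefficients of a function in
  the span that is 1 at the Coxeter element of \<open>\<kappa>\<close> and 0 at the others.\<close>

lemma cox_char_inverse:
  assumes "symmetric_group_characters n chi"
  obtains K where
    "\<And>\<kappa> \<nu>. \<kappa> \<in> partitions n \<Longrightarrow> \<nu> \<in> partitions n \<Longrightarrow>
       (\<Sum>\<mu>\<in>partitions n. K \<kappa> \<mu> * cox_char n chi \<mu> \<nu>) = (if \<kappa> = \<nu> then 1 else 0)"
    "\<And>\<kappa> \<nu>. \<kappa> \<in> partitions n \<Longrightarrow> \<nu> \<in> partitions n \<Longrightarrow>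
       (\<Sum>\<mu>\<in>partitions n. cox_char n chi \<kappa> \<mu> * K \<mu> \<nu>) = (if \<kappa> = \<nu> then 1 else 0)"
proof -
  have "\<exists>c. \<forall>\<nu>\<in>partitions n. (\<Sum>\<mu>\<in>partitions n. c \<mu> * cox_char n chi \<mu> \<nu>) = (if \<kappa> = \<nu> then 1 else 0)"
    if \<kappa>: "\<kappa> \<in> partitions n" for \<kappa>
  proof -
    obtain f where f: "f \<in> char_span n chi" "f (coxeter_element n \<kappa>) = 1"
      "\<forall>\<nu>\<in>partitions n - {\<kappa>}. f (coxeter_element n \<nu>) = 0"
      using char_span_separates[OF assms \<kappa>] by blast
    then obtain c where "\<forall>w\<in>Sym n. f w = (\<Sum>\<mu>\<in>partitions n. c \<mu> * chi \<mu> w)"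
      by (auto simp: char_span_def)
    then have "(\<Sum>\<mu>\<in>partitions n. c \<mu> * cox_char n chi \<mu> \<nu>) = f (coxeter_element n \<nu>)" for \<nu>
      using coxeter_element_Sym by simp
    then show ?thesis using f by (intro exI[of _ c]) auto
  qed
  then obtain K where K: "\<And>\<kappa> \<nu>. \<kappa> \<in> partitions n \<Longrightarrow> \<nu> \<in> partitions n \<Longrightarrow>
      (\<Sum>\<mu>\<in>partitions n. K \<kappa> \<mu> * cox_char n chi \<mu> \<nu>) = (if \<kappa> = \<nu> then 1 else 0)"
    by metis
  show thesis
    by (rule that[OF K finite_matrix_left_inverse_imp_right_inverse[OF finite_partitions K]])
qed

section \<open>Multiplication matrices\<close>

lemma series_of_rat_hom [simp]:
  "series_of_rat 0 = 0" "series_of_rat 1 = 1"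
  "series_of_rat (a + b) = series_of_rat a + series_of_rat b"
  "series_of_rat (a * b) = series_of_rat a * series_of_rat b"
  by (simp_all add: series_of_rat_def)

lemma series_of_rat_sum: "series_of_rat (sum f I) = (\<Sum>i\<in>I. series_of_rat (f i))"
  by (induction I rule: infinite_finite_induct) simp_all

lemma coeff_mult_series_of_rat:
  "fps_nth (fps_nth (x * series_of_rat c) i) j = fps_nth (fps_nth x i) j * c"
  by (simp add: series_of_rat_def)

locale cox_char_table =
  fixes n :: nat and chi :: "nat list \<Rightarrow> (nat \<Rightarrow> nat) \<Rightarrow> rat" and K :: "nat list \<Rightarrow> nat list \<Rightarrow> rat"
  assumes characters: "symmetric_group_characters n chi"
    and K_left: "\<kappa> \<in> partitions n \<Longrightarrow> \<nu> \<in> partitions n \<Longrightarrow>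
       (\<Sum>\<mu>\<in>partitions n. K \<kappa> \<mu> * cox_char n chi \<mu> \<nu>) = (if \<kappa> = \<nu> then 1 else 0)"
    and K_right: "\<kappa> \<in> partitions n \<Longrightarrow> \<nu> \<in> partitions n \<Longrightarrow>
       (\<Sum>\<mu>\<in>partitions n. cox_char n chi \<kappa> \<mu> * K \<mu> \<nu>) = (if \<kappa> = \<nu> then 1 else 0)"
begin

abbreviation X :: "nat list \<Rightarrow> nat list \<Rightarrow> series" where
  "X \<mu> \<kappa> \<equiv> series_of_rat (cox_char n chi \<mu> \<kappa>)"

abbreviation Y :: "nat list \<Rightarrow> nat list \<Rightarrow> series" where
  "Y \<kappa> \<mu> \<equiv> series_of_rat (K \<kappa> \<mu>)"

lemma sum_delta_mult:
  assumes "\<kappa> \<in> partitions n"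
  shows "(\<Sum>\<nu>\<in>partitions n. (if \<kappa> = \<nu> then 1 else 0) * g \<nu>) = (g \<kappa> :: 'b::semiring_1)"
proof -
  have "(\<Sum>\<nu>\<in>partitions n. (if \<kappa> = \<nu> then 1 else 0) * g \<nu>) = (\<Sum>\<nu>\<in>partitions n. if \<kappa> = \<nu> then g \<nu> else 0)"
    by (rule sum.cong) auto
  then show ?thesis using assms finite_partitions by simp
qed

lemma Y_X:
  assumes "\<kappa> \<in> partitions n"
  shows "(\<Sum>\<mu>\<in>partitions n. Y \<kappa> \<mu> * (\<Sum>\<nu>\<in>partitions n. X \<mu> \<nu> * g \<nu>)) = g \<kappa>"
proof -
  have "(\<Sum>\<mu>\<in>partitions n. Y \<kappa> \<mu> * (\<Sum>\<nu>\<in>partitions n. X \<mu> \<nu> * g \<nu>)) =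
        (\<Sum>\<nu>\<in>partitions n. (\<Sum>\<mu>\<in>partitions n. Y \<kappa> \<mu> * X \<mu> \<nu>) * g \<nu>)"
    unfolding sum_distrib_left sum_distrib_right by (subst sum.swap) (simp only: mult.assoc)
  also have "\<dots> = (\<Sum>\<nu>\<in>partitions n. (if \<kappa> = \<nu> then 1 else 0) * g \<nu>)"
    by (rule sum.cong[OF refl])
      (simp add: K_left[OF assms] flip: series_of_rat_hom(4) series_of_rat_sum)
  finally show ?thesis using sum_delta_mult[OF assms] by metis
qed

lemma X_Y:
  assumes "\<kappa> \<in> partitions n"
  shows "(\<Sum>\<mu>\<in>partitions n. X \<kappa> \<mu> * (\<Sum>\<nu>\<in>partitions n. Y \<mu> \<nu> * g \<nu>)) = g \<kappa>"
proof -
  have "(\<Sum>\<mu>\<in>partitions n. X \<kappa> \<mu> * (\<Sum>\<nu>\<in>partitions n. Y \<mu> \<nu> * g \<nu>)) =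
        (\<Sum>\<nu>\<in>partitions n. (\<Sum>\<mu>\<in>partitions n. X \<kappa> \<mu> * Y \<mu> \<nu>) * g \<nu>)"
    unfolding sum_distrib_left sum_distrib_right by (subst sum.swap) (simp only: mult.assoc)
  also have "\<dots> = (\<Sum>\<nu>\<in>partitions n. (if \<kappa> = \<nu> then 1 else 0) * g \<nu>)"
    by (rule sum.cong[OF refl])
      (simp add: K_right[OF assms] flip: series_of_rat_hom(4) series_of_rat_sum)
  finally show ?thesis using sum_delta_mult[OF assms] by metis
qed

lemma X_cancel:
  "(\<forall>\<gamma>\<in>partitions n. (\<Sum>\<kappa>\<in>partitions n. X \<gamma> \<kappa> * g \<kappa>) = (\<Sum>\<kappa>\<in>partitions n. X \<gamma> \<kappa> * h \<kappa>)) \<longleftrightarrow>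
   (\<forall>\<kappa>\<in>partitions n. g \<kappa> = h \<kappa>)"
proof
  assume L: "\<forall>\<gamma>\<in>partitions n. (\<Sum>\<kappa>\<in>partitions n. X \<gamma> \<kappa> * g \<kappa>) = (\<Sum>\<kappa>\<in>partitions n. X \<gamma> \<kappa> * h \<kappa>)"
  show "\<forall>\<kappa>\<in>partitions n. g \<kappa> = h \<kappa>"
  proof
    fix \<kappa> assume \<kappa>: "\<kappa> \<in> partitions n"
    have "(\<Sum>\<mu>\<in>partitions n. Y \<kappa> \<mu> * (\<Sum>\<nu>\<in>partitions n. X \<mu> \<nu> * g \<nu>)) =
          (\<Sum>\<mu>\<in>partitions n. Y \<kappa> \<mu> * (\<Sum>\<nu>\<in>partitions n. X \<mu> \<nu> * h \<nu>))"
      using L by (intro sum.cong) auto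
    then show "g \<kappa> = h \<kappa>" unfolding Y_X[OF \<kappa>] .
  qed
qed simp

text \<open>The inner sums over \<open>\<mu>\<close> form the basis of the span dual to evaluation
  at the Coxeter elements, so a function in the span is determined by these values. This plays the
  part of the Coxeter elements representing all conjugacy classes.\<close>

lemma char_span_interpolation:
  assumes "f \<in> char_span n chi" "w \<in> Sym n"
  shows "f w = (\<Sum>\<kappa>\<in>partitions n. f (coxeter_element n \<kappa>) * (\<Sum>\<mu>\<in>partitions n. K \<kappa> \<mu> * chi \<mu> w))"
proof -
  let ?P = "partitions n"
  obtain c where c: "\<And>w. w \<in> Sym n \<Longrightarrow> f w = (\<Sum>\<nu>\<in>?P. c \<nu> * chi \<nu> w)"
    using assms(1) by (auto simp: char_span_def)
  have "(\<Sum>\<kappa>\<in>?P. cox_char n chi \<nu> \<kappa> * (\<Sum>\<mu>\<in>?P. K \<kappa> \<mu> * chi \<mu> w)) = chi \<nu> w" if "\<nu> \<in> ?P" for \<nu>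
  proof -
    have "(\<Sum>\<kappa>\<in>?P. cox_char n chi \<nu> \<kappa> * (\<Sum>\<mu>\<in>?P. K \<kappa> \<mu> * chi \<mu> w)) =
          (\<Sum>\<mu>\<in>?P. (\<Sum>\<kappa>\<in>?P. cox_char n chi \<nu> \<kappa> * K \<kappa> \<mu>) * chi \<mu> w)"
      unfolding sum_distrib_left sum_distrib_right by (subst sum.swap) (simp only: mult.assoc)
    also have "\<dots> = (\<Sum>\<mu>\<in>?P. (if \<nu> = \<mu> then 1 else 0) * chi \<mu> w)"
      by (rule sum.cong[OF refl]) (simp only: K_right[OF that])
    finally show ?thesis using sum_delta_mult[OF that] by metis
  qed
  then have "f w = (\<Sum>\<nu>\<in>?P. c \<nu> * (\<Sum>\<kappa>\<in>?P. cox_char n chi \<nu> \<kappa> * (\<Sum>\<mu>\<in>?P. K \<kappa> \<mu> * chi \<mu> w)))"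
    using c[OF assms(2)] by simp
  also have "\<dots> = (\<Sum>\<kappa>\<in>?P. (\<Sum>\<nu>\<in>?P. c \<nu> * cox_char n chi \<nu> \<kappa>) * (\<Sum>\<mu>\<in>?P. K \<kappa> \<mu> * chi \<mu> w))"
    unfolding sum_distrib_left[of "c _" "\<lambda>\<kappa>. cox_char n chi _ \<kappa> * _ \<kappa>"] sum_distrib_right
    by (subst sum.swap) (simp only: mult.assoc)
  also have "\<dots> = (\<Sum>\<kappa>\<in>?P. f (coxeter_element n \<kappa>) * (\<Sum>\<mu>\<in>?P. K \<kappa> \<mu> * chi \<mu> w))"
    using c[OF coxeter_element_Sym] by simp
  finally show ?thesis .
qed

text \<open>The formula is X diag(\<open>\<zeta>\<close>) Y. The hypothesis is stated
  coefficientwise because \<open>\<zeta>\<close> has power series as values while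
  \<open>char_span\<close> is a space of rational functions on the group.\<close>

lemma mult_matrix_eq:
  assumes \<zeta>: "\<And>i j f. f \<in> char_span n chi \<Longrightarrow> (\<lambda>w. fps_nth (fps_nth (\<zeta> w) i) j * f w) \<in> char_span n chi"
    and "\<gamma> \<in> partitions n" "\<nu> \<in> partitions n"
  shows "mult_matrix n chi \<zeta> \<gamma> \<nu> =
    (\<Sum>\<kappa>\<in>partitions n. X \<gamma> \<kappa> * (\<zeta> (coxeter_element n \<kappa>) * Y \<kappa> \<nu>))"
proof -
  let ?P = "partitions n"
  let ?e = "\<lambda>c. \<forall>w\<in>Sym n. char_tensor \<zeta> (\<lambda>w. series_of_rat (chi \<gamma> w)) w =
                        (\<Sum>\<mu>\<in>?P. c \<mu> * series_of_rat (chi \<mu> w))"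
  let ?c = "\<lambda>\<nu>. \<Sum>\<kappa>\<in>?P. X \<gamma> \<kappa> * (\<zeta> (coxeter_element n \<kappa>) * Y \<kappa> \<nu>)"
  have "?e ?c"
  proof
    fix w assume w: "w \<in> Sym n"
    have "\<zeta> w * series_of_rat (chi \<gamma> w) =
      (\<Sum>\<kappa>\<in>?P. (\<zeta> (coxeter_element n \<kappa>) * X \<gamma> \<kappa>) * series_of_rat (\<Sum>\<mu>\<in>?P. K \<kappa> \<mu> * chi \<mu> w))"
    proof (intro fps_ext)
      fix i j
      show "fps_nth (fps_nth (\<zeta> w * series_of_rat (chi \<gamma> w)) i) j = fps_nth (fps_nth
        (\<Sum>\<kappa>\<in>?P. (\<zeta> (coxeter_element n \<kappa>) * X \<gamma> \<kappa>) * series_of_rat (\<Sum>\<mu>\<in>?P. K \<kappa> \<mu> * chi \<mu> w)) i) j"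
        unfolding fps_sum_nth coeff_mult_series_of_rat
        by (rule char_span_interpolation[OF \<zeta>[OF char_span_chi[OF assms(2)]] w])
    qed
    also have "\<dots> = (\<Sum>\<mu>\<in>?P. ?c \<mu> * series_of_rat (chi \<mu> w))"
      unfolding series_of_rat_sum series_of_rat_hom(4) sum_distrib_left sum_distrib_right
      by (subst sum.swap) (simp only: mult_ac)
    finally show "char_tensor \<zeta> (\<lambda>w. series_of_rat (chi \<gamma> w)) w =
      (\<Sum>\<mu>\<in>?P. ?c \<mu> * series_of_rat (chi \<mu> w))" by (simp only: char_tensor_def)
  qed
  \<comment> \<open>One solution has been exhibited, so the chosen row solves the expansion as well.
    Its values at the Coxeter elements then determine it, by multiplying with \<open>Y\<close> on
    the right.\<close>
  then have "?e (SOME c. ?e c)" by (rule someI[of ?e ?c])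
  then have "?e (mult_matrix n chi \<zeta> \<gamma>)" by (simp only: mult_matrix_def)
  then have eq: "\<zeta> (coxeter_element n \<kappa>) * X \<gamma> \<kappa> = (\<Sum>\<mu>\<in>?P. mult_matrix n chi \<zeta> \<gamma> \<mu> * X \<mu> \<kappa>)" for \<kappa>
    using coxeter_element_Sym by (simp add: char_tensor_def)
  have "?c \<nu> = (\<Sum>\<kappa>\<in>?P. (\<zeta> (coxeter_element n \<kappa>) * X \<gamma> \<kappa>) * Y \<kappa> \<nu>)"
    by (simp only: mult_ac)
  also have "\<dots> = (\<Sum>\<mu>\<in>?P. mult_matrix n chi \<zeta> \<gamma> \<mu> * (\<Sum>\<kappa>\<in>?P. X \<mu> \<kappa> * Y \<kappa> \<nu>))"
    unfolding eq sum_distrib_left sum_distrib_right by (subst sum.swap) (simp only: mult.assoc)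
  also have "\<dots> = (\<Sum>\<mu>\<in>?P. (if \<nu> = \<mu> then 1 else 0) * mult_matrix n chi \<zeta> \<gamma> \<mu>)"
    by (rule sum.cong[OF refl])
      (simp add: K_right assms(3) flip: series_of_rat_hom(4) series_of_rat_sum)
  finally show ?thesis using sum_delta_mult[OF assms(3)] by metis
qed

end


section \<open>Specializing \<open>q\<close> to \<open>t = -r\<close>\<close>

text \<open>Substitution of t = -r for the variable; the result is constant in q. Its counterpart is
  \<open>fps_const\<close>, which keeps the variable as q.\<close>

definition at_t :: "rat fps \<Rightarrow> series" where
  "at_t g = Abs_fps (\<lambda>j. fps_const ((- 1) ^ j * fps_nth g j))"

lemma at_t_simps:
  "at_t 0 = 0" "at_t (f + g) = at_t f + at_t g" "at_t (f - g) = at_t f - at_t g"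
  "at_t (fps_const c) = series_of_rat c" "at_t fps_X = series_t" "at_t 1 = 1"
  by (auto simp: at_t_def fps_eq_iff algebra_simps series_of_rat_def series_t_def series_r_def)

lemma fps_const_sum: "fps_const (sum f I) = (\<Sum>i\<in>I. fps_const (f i))"
  by (induction I rule: infinite_finite_induct) (simp_all flip: fps_const_add)

lemma at_t_mult: "at_t (f * g) = at_t f * at_t g"
proof (rule fps_ext)
  fix k
  have "fps_nth (at_t (f * g)) k =
        fps_const (\<Sum>i=0..k. (- 1) ^ k * (fps_nth f i * fps_nth g (k - i)))"
    by (simp add: at_t_def fps_mult_nth sum_distrib_left)
  also have "(\<Sum>i=0..k. (- 1) ^ k * (fps_nth f i * fps_nth g (k - i))) =
      (\<Sum>i=0..k. ((- 1) ^ i * fps_nth f i) * ((- 1) ^ (k - i) * fps_nth g (k - i)))"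
  proof (rule sum.cong[OF refl])
    fix i assume "i \<in> {0..k}"
    then have "(- 1 :: rat) ^ k = (- 1) ^ i * (- 1) ^ (k - i)" by (simp flip: power_add)
    then show "(- 1) ^ k * (fps_nth f i * fps_nth g (k - i)) =
      ((- 1) ^ i * fps_nth f i) * ((- 1) ^ (k - i) * fps_nth g (k - i))" by simp
  qed
  finally show "fps_nth (at_t (f * g)) k = fps_nth (at_t f * at_t g) k"
    by (simp add: at_t_def fps_mult_nth fps_const_sum)
qed

lemma at_t_power: "at_t (f ^ k) = at_t f ^ k"
  by (induction k) (simp_all add: at_t_simps at_t_mult)

lemma at_t_sum: "at_t (sum f I) = (\<Sum>i\<in>I. at_t (f i))"
  by (induction I rule: infinite_finite_induct) (simp_all add: at_t_simps)

text \<open>Independence of q and r enters here: in g(q) = g(-r) the coefficient of r^0 is g(q) on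
  the left and the constant g(0) on the right.\<close>

lemma fps_const_eq_at_t_iff:
  "fps_const g = at_t g \<longleftrightarrow> fps_const g = series_of_rat (fps_nth g 0)"
proof
  assume L: "fps_const g = at_t g"
  have "fps_nth (fps_const g) 0 = fps_nth (at_t g) 0" by (simp only: L)
  then show "fps_const g = series_of_rat (fps_nth g 0)" by (simp add: at_t_def series_of_rat_def)
next
  assume "fps_const g = series_of_rat (fps_nth g 0)"
  then have "g = fps_const (fps_nth g 0)" by (simp add: series_of_rat_def)
  then have "at_t g = series_of_rat (fps_nth g 0)" by (metis at_t_simps(4))
  then show "fps_const g = at_t g" using \<open>fps_const g = series_of_rat (fps_nth g 0)\<close> by simp
qed

lemma poly_at_pCons: "poly_at x (pCons a p) = series_of_rat a + x * poly_at x p"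
  by (simp add: poly_at_def map_poly_pCons)

lemma poly_at_t: "poly_at series_t p = at_t (fps_of_poly p)"
proof (induction p)
  case 0
  then show ?case by (simp add: poly_at_def at_t_simps)
next
  case (pCons a p)
  then show ?case by (simp add: poly_at_pCons fps_of_poly_pCons at_t_simps at_t_mult mult.commute)
qed

lemma poly_at_q: "poly_at series_q p = fps_const (fps_of_poly p)"
proof (induction p)
  case 0
  then show ?case by (simp add: poly_at_def)
next
  case (pCons a p)
  then show ?case
    by (simp add: poly_at_pCons fps_of_poly_pCons series_q_def series_of_rat_def mult.commute)
qed

lemma poly_at_0: "poly_at 0 p = series_of_rat (fps_nth (fps_of_poly p) 0)"
  by (cases p) (simp add: poly_at_pCons)

lemma zeta_S_series_eq: "zeta_S_series n w = fps_const (sym_series {1..n} w)"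
  by (simp add: zeta_S_series_def zeta_S_eq fps_eq_iff)

lemma zeta_A_series_eq: "zeta_A_series n w = at_t (ext_series {1..n} w)"
  by (simp add: zeta_A_series_def at_t_def zeta_A_eq)

lemma char_span_zeta_S_series:
  assumes "symmetric_group_characters n chi" "f \<in> char_span n chi"
  shows "(\<lambda>w. fps_nth (fps_nth (zeta_S_series n w) i) j * f w) \<in> char_span n chi"
proof (cases "i = 0")
  case True
  then show ?thesis using zeta_S_mult_in_char_span[OF assms, of j] by (simp add: zeta_S_series_def)
next
  case False
  then show ?thesis by (simp add: zeta_S_series_def char_span_zero)
qed

text \<open>The outer index \<open>i\<close> is the exponent of r and the inner index
  \<open>j\<close> that of q, so the coefficient is
  \<open>zeta_A n i w * zeta_S n j w\<close>.\<close>

lemma char_span_zeta_S_zeta_A_series: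
  assumes "symmetric_group_characters n chi" "f \<in> char_span n chi"
  shows "(\<lambda>w. fps_nth (fps_nth (char_tensor (zeta_S_series n) (zeta_A_series n) w) i) j * f w)
           \<in> char_span n chi"
proof -
  have "(\<lambda>w. (- 1) ^ i * (fps_nth (ext_series {1..n} w) i * (zeta_S n j w * f w))) \<in> char_span n chi"
    by (intro char_span_scale ext_series_mult_in_char_span zeta_S_mult_in_char_span assms)
  then show ?thesis
    by (rule char_span_cong)
      (simp add: char_tensor_def zeta_S_series_def zeta_A_series_def zeta_A_eq)
qed

text \<open>Since 1 - t = 1 + r, the power \<open>L\<close> on the left cancels \<open>L\<close> of
  the \<open>n\<close> denominators; the remaining \<open>l\<close> are cleared to the right, and
  \<open>q' ^ L\<close> is cancelled on both sides.\<close>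

lemma series_mult_cancel_units:
  fixes A T q' :: series
  assumes "q' \<noteq> 0" "L + l = n"
  shows "(1 - series_t) ^ L * ((q' * inverse (1 + series_r)) ^ n * A) = q' ^ L * T \<longleftrightarrow>
         q' ^ l * A = (1 - series_t) ^ l * T"
proof -
  let ?u = "1 + series_r"
  have t: "1 - series_t = ?u" by (simp add: series_t_def)
  have "fps_nth ?u 0 = (1 :: rat fps)" by (simp add: series_r_def)
  \<comment> \<open>The coefficients \<open>rat fps\<close> do not form a field, but the constant
    term of \<open>?u\<close> is 1, which makes \<open>inverse\<close> a true right inverse.\<close>
  then have inv: "?u * inverse ?u = 1"
    by (subst fps_inverse_def, intro fps_right_inverse) simp
  have u: "?u \<noteq> 0" using inv by auto
  have "?u ^ l * (?u ^ L * ((q' * inverse ?u) ^ n * A)) = (?u * inverse ?u) ^ n * (q' ^ n * A)"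
    unfolding assms(2)[symmetric] by (simp add: power_add power_mult_distrib mult_ac)
  also have "\<dots> = q' ^ L * (q' ^ l * A)"
    unfolding inv assms(2)[symmetric] by (simp add: power_add mult_ac)
  finally have eq: "?u ^ l * (?u ^ L * ((q' * inverse ?u) ^ n * A)) = q' ^ L * (q' ^ l * A)" .
  have "?u ^ L * ((q' * inverse ?u) ^ n * A) = q' ^ L * T \<longleftrightarrow>
        ?u ^ l * (?u ^ L * ((q' * inverse ?u) ^ n * A)) = ?u ^ l * (q' ^ L * T)"
    using u by (metis mult_left_cancel power_not_zero)
  also have "\<dots> \<longleftrightarrow> q' ^ L * (q' ^ l * A) = q' ^ L * (?u ^ l * T)"
    unfolding eq by (simp only: mult.left_commute)
  also have "\<dots> \<longleftrightarrow> q' ^ l * A = ?u ^ l * T"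
    using assms(1) by (metis mult_left_cancel power_not_zero)
  finally show ?thesis unfolding t .
qed


section \<open>The two conditions, column by column\<close>

context cox_char_table
begin

text \<open>
  Both conditions say that every \<open>g \<kappa> \<beta>\<close>, the row of \<open>X\<^sup>-\<^sup>1\<close> at \<open>\<kappa>\<close> applied to the relation, is
  constant: the duality compares its values at \<open>q\<close> and at \<open>t\<close>, the other relation its values at
  \<open>q\<close> and at \<open>0\<close>.
\<close>

definition g where
  "g chi_q \<kappa> \<beta> = sym_series {1..n} (coxeter_element n \<kappa>) *
     (\<Sum>\<mu>\<in>partitions n. fps_const (K \<kappa> \<mu>) * fps_of_poly (chi_q \<mu> (coxeter_element n \<beta>))) *
     (1 - fps_X) ^ length \<beta>"

lemma series_of_rat_eq: "series_of_rat c = fps_const (fps_const c)"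
  by (simp add: series_of_rat_def)

lemma g_at_q:
  "fps_const (g chi_q \<kappa> \<beta>) = (1 - series_q) ^ length \<beta> * (zeta_S_series n (coxeter_element n \<kappa>) *
     (\<Sum>\<mu>\<in>partitions n. Y \<kappa> \<mu> * poly_at series_q (chi_q \<mu> (coxeter_element n \<beta>))))"
proof -
  have "1 - series_q = fps_const (1 - fps_X)" by (simp add: series_q_def flip: fps_const_sub)
  then show ?thesis
    by (simp add: g_def zeta_S_series_eq poly_at_q series_of_rat_eq mult_ac flip: fps_const_sum)
qed

lemma g_at_t:
  "at_t (g chi_q \<kappa> \<beta>) = at_t (sym_series {1..n} (coxeter_element n \<kappa>)) *
     ((1 - series_t) ^ length \<beta> *
       (\<Sum>\<mu>\<in>partitions n. Y \<kappa> \<mu> * poly_at series_t (chi_q \<mu> (coxeter_element n \<beta>))))"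
  by (simp add: g_def poly_at_t at_t_mult at_t_power at_t_sum at_t_simps mult_ac)

text \<open>Both the symmetric generating function and the power of 1 - q have constant term 1, so
  only the specialized table survives at q = 0.\<close>

lemma g_at_0:
  "series_of_rat (fps_nth (g chi_q \<kappa> \<beta>) 0) =
     (\<Sum>\<mu>\<in>partitions n. Y \<kappa> \<mu> * poly_at 0 (chi_q \<mu> (coxeter_element n \<beta>)))"
proof -
  have "invariant_multisets {1..n} (coxeter_element n \<kappa>) 0 = {{#}}"
    by (auto simp: invariant_multisets_def)
  then have "fps_nth (sym_series {1..n} (coxeter_element n \<kappa>)) 0 = 1"
    by (simp add: sym_series_def)
  then have "fps_nth (g chi_q \<kappa> \<beta>) 0 =
      (\<Sum>\<mu>\<in>partitions n. K \<kappa> \<mu> * fps_nth (fps_of_poly (chi_q \<mu> (coxeter_element n \<beta>))) 0)"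
    by (simp add: g_def fps_sum_nth fps_power_zeroth)
  then show ?thesis by (simp only: poly_at_0 series_of_rat_sum series_of_rat_hom)
qed

lemma at_t_sym_series_mult_zeta_A_series:
  "at_t (sym_series {1..n} (coxeter_element n \<kappa>)) * zeta_A_series n (coxeter_element n \<kappa>) = 1"
proof -
  note w = coxeter_element_permutes[of n \<kappa>]
  have "sym_series {1..n} (coxeter_element n \<kappa>) * ext_series {1..n} (coxeter_element n \<kappa>) = 1"
    by (rule sym_series_mult_ext_series[OF _ permutes_inj[OF w] permutes_image[OF w]]) simp
  then show ?thesis unfolding zeta_A_series_eq by (simp only: at_t_simps flip: at_t_mult)
qed

lemma sum_mult_matrix:
  assumes "\<And>i j f. f \<in> char_span n chi \<Longrightarrow> (\<lambda>w. fps_nth (fps_nth (\<zeta> w) i) j * f w) \<in> char_span n chi"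
    and "\<gamma> \<in> partitions n"
  shows "(\<Sum>\<mu>\<in>partitions n. mult_matrix n chi \<zeta> \<gamma> \<mu> * F \<mu>) =
    (\<Sum>\<kappa>\<in>partitions n. X \<gamma> \<kappa> * (\<zeta> (coxeter_element n \<kappa>) * (\<Sum>\<mu>\<in>partitions n. Y \<kappa> \<mu> * F \<mu>)))"
proof -
  have "(\<Sum>\<mu>\<in>partitions n. mult_matrix n chi \<zeta> \<gamma> \<mu> * F \<mu>) =
    (\<Sum>\<mu>\<in>partitions n. (\<Sum>\<kappa>\<in>partitions n. X \<gamma> \<kappa> * (\<zeta> (coxeter_element n \<kappa>) * Y \<kappa> \<mu>)) * F \<mu>)"
    by (rule sum.cong[OF refl]) (simp only: mult_matrix_eq[OF assms])
  also have "\<dots> = (\<Sum>\<kappa>\<in>partitions n. X \<gamma> \<kappa> * (\<zeta> (coxeter_element n \<kappa>) * (\<Sum>\<mu>\<in>partitions n. Y \<kappa> \<mu> * F \<mu>)))"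
    unfolding sum_distrib_left sum_distrib_right by (subst sum.swap) (simp only: mult.assoc)
  finally show ?thesis .
qed

lemma mult_sum_X: "c * (\<Sum>\<kappa>\<in>partitions n. X \<gamma> \<kappa> * f \<kappa>) = (\<Sum>\<kappa>\<in>partitions n. X \<gamma> \<kappa> * (c * f \<kappa>))"
  by (simp add: sum_distrib_left mult.left_commute)

text \<open>The column \<open>\<beta>\<close> stays fixed while \<open>\<gamma>\<close> varies,
  because the inverse of \<open>X\<close> mixes rows only. Both sides of the duality are written as
  \<open>X\<close> applied to a vector, and \<open>X\<close> is cancelled.\<close>

lemma duality_iff:
  assumes "\<beta> \<in> partitions n"
  shows "(\<forall>\<gamma>\<in>partitions n.
      (1 - series_t) ^ coxeter_length n (coxeter_element n \<beta>) *
        markov_trace n chi chi_q \<gamma> (coxeter_element n \<beta>) =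
      (1 - series_q) ^ coxeter_length n (coxeter_element n \<beta>) *
        poly_at series_t (chi_q \<gamma> (coxeter_element n \<beta>))) \<longleftrightarrow>
    (\<forall>\<kappa>\<in>partitions n. fps_const (g chi_q \<kappa> \<beta>) = at_t (g chi_q \<kappa> \<beta>))"
    (is "(\<forall>\<gamma>\<in>?P. ?D \<gamma>) \<longleftrightarrow> _")
proof -
  let ?w = "coxeter_element n"
  let ?G = "\<lambda>\<kappa>. \<Sum>\<mu>\<in>?P. Y \<kappa> \<mu> * poly_at series_q (chi_q \<mu> (?w \<beta>))"
  let ?H = "\<lambda>\<kappa>. \<Sum>\<mu>\<in>?P. Y \<kappa> \<mu> * poly_at series_t (chi_q \<mu> (?w \<beta>))"
  let ?q = "(1 - series_q) ^ length \<beta>" and ?t = "(1 - series_t) ^ length \<beta>"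
  let ?S = "\<lambda>\<kappa>. zeta_S_series n (?w \<kappa>)" and ?A = "\<lambda>\<kappa>. zeta_A_series n (?w \<kappa>)"
    and ?S\<^sub>t = "\<lambda>\<kappa>. at_t (sym_series {1..n} (?w \<kappa>))"
  have "fps_nth (fps_nth (1 - series_q) 0) 0 = (1 :: rat)" by (simp add: series_q_def)
  then have q: "1 - series_q \<noteq> 0" by auto
  have "?D \<gamma> \<longleftrightarrow> (\<Sum>\<kappa>\<in>?P. X \<gamma> \<kappa> * (?q * (?S \<kappa> * ?A \<kappa> * ?G \<kappa>))) = (\<Sum>\<kappa>\<in>?P. X \<gamma> \<kappa> * (?t * ?H \<kappa>))"
    if \<gamma>: "\<gamma> \<in> ?P" for \<gamma>
  proof -
    have sum: "(\<Sum>\<mu>\<in>?P. mult_matrix n chi (char_tensor (zeta_S_series n) (zeta_A_series n)) \<gamma> \<mu> *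
        poly_at series_q (chi_q \<mu> (?w \<beta>))) = (\<Sum>\<kappa>\<in>?P. X \<gamma> \<kappa> * (?S \<kappa> * ?A \<kappa> * ?G \<kappa>))"
      using sum_mult_matrix[of "char_tensor (zeta_S_series n) (zeta_A_series n)",
          OF char_span_zeta_S_zeta_A_series[OF characters] \<gamma>]
      by (simp only: char_tensor_def)
    have D: "?D \<gamma> \<longleftrightarrow> ?q * (\<Sum>\<kappa>\<in>?P. X \<gamma> \<kappa> * (?S \<kappa> * ?A \<kappa> * ?G \<kappa>)) = ?t * poly_at series_t (chi_q \<gamma> (?w \<beta>))"
      unfolding markov_trace_def series_mult_cancel_units[OF q coxeter_length_coxeter_element[OF assms]] sum ..
    have T: "poly_at series_t (chi_q \<gamma> (?w \<beta>)) = (\<Sum>\<kappa>\<in>?P. X \<gamma> \<kappa> * ?H \<kappa>)"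
      by (rule X_Y[OF \<gamma>, symmetric])
    show ?thesis unfolding D unfolding T mult_sum_X ..
  qed
  then have "(\<forall>\<gamma>\<in>?P. ?D \<gamma>) \<longleftrightarrow> (\<forall>\<kappa>\<in>?P. ?q * (?S \<kappa> * ?A \<kappa> * ?G \<kappa>) = ?t * ?H \<kappa>)"
    using X_cancel by simp
  also have "\<dots> \<longleftrightarrow> (\<forall>\<kappa>\<in>?P. fps_const (g chi_q \<kappa> \<beta>) = at_t (g chi_q \<kappa> \<beta>))"
  proof (rule ball_cong[OF refl])
    fix \<kappa>
    \<comment> \<open>Multiplying by the symmetric series at t removes the exterior factor on the
      left and completes the right side to \<open>g\<close> at t.\<close>
    have unit: "?S\<^sub>t \<kappa> * ?A \<kappa> = 1" by (rule at_t_sym_series_mult_zeta_A_series)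
    then have "?S\<^sub>t \<kappa> \<noteq> 0" by auto
    then have "?q * (?S \<kappa> * ?A \<kappa> * ?G \<kappa>) = ?t * ?H \<kappa> \<longleftrightarrow>
        ?S\<^sub>t \<kappa> * (?q * (?S \<kappa> * ?A \<kappa> * ?G \<kappa>)) = ?S\<^sub>t \<kappa> * (?t * ?H \<kappa>)"
      by simp
    also have "?S\<^sub>t \<kappa> * (?q * (?S \<kappa> * ?A \<kappa> * ?G \<kappa>)) = (?S\<^sub>t \<kappa> * ?A \<kappa>) * (?q * (?S \<kappa> * ?G \<kappa>))"
      by (simp only: mult_ac)
    finally show "?q * (?S \<kappa> * ?A \<kappa> * ?G \<kappa>) = ?t * ?H \<kappa> \<longleftrightarrow>
        fps_const (g chi_q \<kappa> \<beta>) = at_t (g chi_q \<kappa> \<beta>)"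
      unfolding g_at_q g_at_t unit by (simp only: mult_1_left)
  qed
  finally show ?thesis .
qed

lemma table_relation_iff:
  assumes "\<beta> \<in> partitions n"
  shows "(\<forall>\<gamma>\<in>partitions n.
      part_mat_mult n
        (part_mat_mult n (mult_matrix n chi (zeta_S_series n)) (character_table n chi_q series_q))
        (part_mat_diag (\<lambda>\<beta>. (1 - series_q) ^ length \<beta>)) \<gamma> \<beta> = character_table n chi_q 0 \<gamma> \<beta>) \<longleftrightarrow>
    (\<forall>\<kappa>\<in>partitions n. fps_const (g chi_q \<kappa> \<beta>) = series_of_rat (fps_nth (g chi_q \<kappa> \<beta>) 0))"
    (is "(\<forall>\<gamma>\<in>?P. ?D \<gamma> = _) \<longleftrightarrow> _")
proof -
  let ?w = "coxeter_element n"
  let ?O = "\<lambda>\<kappa>. \<Sum>\<mu>\<in>?P. Y \<kappa> \<mu> * poly_at 0 (chi_q \<mu> (?w \<beta>))"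
  have "?D \<gamma> = (\<Sum>\<kappa>\<in>?P. X \<gamma> \<kappa> * fps_const (g chi_q \<kappa> \<beta>))" if \<gamma>: "\<gamma> \<in> ?P" for \<gamma>
  proof -
    have "?D \<gamma> = (\<Sum>\<mu>\<in>?P. if \<beta> = \<mu> then part_mat_mult n (mult_matrix n chi (zeta_S_series n))
        (character_table n chi_q series_q) \<gamma> \<mu> * (1 - series_q) ^ length \<mu> else 0)"
      unfolding part_mat_mult_def[of n "part_mat_mult n _ _"] part_mat_diag_def
      by (rule sum.cong) auto
    also have "\<dots> = (1 - series_q) ^ length \<beta> * part_mat_mult n (mult_matrix n chi (zeta_S_series n))
        (character_table n chi_q series_q) \<gamma> \<beta>"
      using assms finite_partitions by (simp add: mult.commute)
    also have "\<dots> = (\<Sum>\<kappa>\<in>?P. X \<gamma> \<kappa> * fps_const (g chi_q \<kappa> \<beta>))"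
      using sum_mult_matrix[of "zeta_S_series n", OF char_span_zeta_S_series[OF characters] \<gamma>]
      by (simp only: part_mat_mult_def character_table_def g_at_q mult_sum_X)
    finally show ?thesis .
  qed
  moreover have "character_table n chi_q 0 \<gamma> \<beta> = (\<Sum>\<kappa>\<in>?P. X \<gamma> \<kappa> * ?O \<kappa>)" if "\<gamma> \<in> ?P" for \<gamma>
    unfolding character_table_def by (rule X_Y[OF that, symmetric])
  ultimately have "(\<forall>\<gamma>\<in>?P. ?D \<gamma> = character_table n chi_q 0 \<gamma> \<beta>) \<longleftrightarrow>
      (\<forall>\<gamma>\<in>?P. (\<Sum>\<kappa>\<in>?P. X \<gamma> \<kappa> * fps_const (g chi_q \<kappa> \<beta>)) = (\<Sum>\<kappa>\<in>?P. X \<gamma> \<kappa> * ?O \<kappa>))"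
    by simp
  then show ?thesis unfolding X_cancel g_at_0 .
qed

end

theorem mainTheorem5:
  fixes n :: nat
    and chi :: "nat list \<Rightarrow> (nat \<Rightarrow> nat) \<Rightarrow> rat"
    and chi_q :: "nat list \<Rightarrow> (nat \<Rightarrow> nat) \<Rightarrow> rat poly"
  assumes "n \<ge> 1"
    and "symmetric_group_characters n chi"
    and "hecke_characters n chi chi_q"
  shows "(\<forall>\<gamma>\<in>partitions n. \<forall>\<beta>\<in>partitions n.
            (1 - series_t) ^ coxeter_length n (coxeter_element n \<beta>) *
              markov_trace n chi chi_q \<gamma> (coxeter_element n \<beta>) =
            (1 - series_q) ^ coxeter_length n (coxeter_element n \<beta>) *
              poly_at series_t (chi_q \<gamma> (coxeter_element n \<beta>)))
         \<longleftrightarrow>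
         part_mat_eq n
           (part_mat_mult n
              (part_mat_mult n (mult_matrix n chi (zeta_S_series n)) (character_table n chi_q series_q))
              (part_mat_diag (\<lambda>\<beta>. (1 - series_q) ^ length \<beta>)))
           (character_table n chi_q 0)"
proof -
  obtain K where "cox_char_table n chi K"
    using cox_char_inverse[OF assms(2)] assms(2) unfolding cox_char_table_def by metis
  then interpret cox_char_table n chi K .
  \<comment> \<open>For each \<open>\<kappa>\<close> and \<open>\<beta>\<close> the two conditions
    on \<open>g\<close> are the two sides of \<open>fps_const_eq_at_t_iff\<close>.\<close>
  show ?thesis
    unfolding part_mat_eq_def
    using duality_iff table_relation_iff fps_const_eq_at_t_iff by blast
qed

end
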